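(* Consider the monodromy data $M\in SL_k(\mathbb C)$ of the Poisson algebra of monodromy data on $\Sigma_{g,s,n}$ that correspond to paths that go clockwise along boundaries of holes, i.e. between neighbouring bordered cusps of a hole, with the hole to the left of the path (they may start and terminate at the same cusp if a hole has only one cusp). The reduction $$m_{i,j}=0\quad\text{for } i+j\ge k+2,$$ i.e. the condition that all entries of $M$ below the main anti-diagonal vanish, is a Poisson reduction.
   Context: $\Sigma_{g,s,n}$ is a surface of genus $g$ with $s$ holes (boundary components) and $n\ge1$ bordered cusps (marked points on the boundary). A monodromy datum is a $k\times k$ matrix $M_{\mathfrak a}=(m_{ij})$ attached to a directed arc $\mathfrak a$ joining cusps. A system of monodromy data is the collection of matrices attached to a system of pairwise nonintersecting arcs; composing paths corresponds to multiplying matrices from the left, and reversing a path corresponds to inverting the matrix. At each cusp the arc ends are linearly ordered so that, looking from the cusp into the surface, smaller ends are to the right. Closed arcs (source cusp equal to target cusp) are directed so that the source end is larger than the target end. Let $r=\frac12\sum_{i,j}e_{ii}\otimes e_{jj}-\sum_ie_{ii}\otimes e_{ii}-2\sum_{j>i}e_{ij}\otimes e_{ji}$ ($e_{ij}$ the matrix units), let $r^T$ be its transpose, $\overset1M=M\otimes1$, $\overset2M=1\otimes M$. The Poisson algebra of monodromy data is the semiclassical limit of the Fock–Rosly type $R$-matrix relations. Explicitly, for different arcs $\mathfrak a,\mathfrak b$ with data $A,B$, $\{\overset1A,\overset2B\}$ is the sum of the following contributions, one for each pair (end of $\mathfrak a$, end of $\mathfrak b$) lying at a common cusp: - source $i$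 of $\mathfrak a$, source $k'$ of $\mathfrak b$: $\overset1A\overset2B\,r$ if $i<k'$, and $-\overset1A\overset2B\,r^T$ if $i>k'$; - target $j$ of $\mathfrak a$, target $l$ of $\mathfrak b$: $r\,\overset1A\overset2B$ if $j<l$, and $-r^T\overset1A\overset2B$ if $j>l$; - source $i$ of $\mathfrak a$, target $l$ of $\mathfrak b$: $-\overset1A\,r\,\overset2B$ if $i<l$, and $\overset1A\,r^T\overset2B$ if $i>l$; - target $j$ of $\mathfrak a$, source $k'$ of $\mathfrak b$: $-\overset2B\,r\,\overset1A$ if $j<k'$, and $\overset2B\,r^T\overset1A$ if $j>k'$. For a single arc with datum $M$: $\{\overset1M,\overset2M\}=\overset1M\overset2M\,r-r^T\overset1M\overset2M$ if the arc is open (different cusps), and $\{\overset1M,\overset2M\}=\overset1M\,r^T\overset2M-r^T\overset1M\overset2M+\overset2M\overset1M\,r-\overset2M\,r\,\overset1M$ if it is closed. A path along a hole boundary with the hole on its left is leftmost (largest end) at its starting cusp and rightmost (smallest end) at its terminating cusp. Imposing $m_{ij}=0$ for a set of entries is a Poisson reduction if the Poisson brackets of these entries with all elements of the algebra vanish once the constraints are imposed (the ideal generated by these entries is a Poisson ideal), so that the bracket restricts to the constrained algebra. *)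

theory Defs
  imports "HOL-Library.Poly_Mapping" "Jordan_Normal_Form.Determinant"
begin

section \<open>Arc systems on bordered surfaces\<close>

datatype 'a arc_end = Src 'a | Tgt 'a

fun other_end :: "'a arc_end \<Rightarrow> 'a arc_end" where
  "other_end (Src a) = Tgt a"
| "other_end (Tgt a) = Src a"

text \<open>
  A system of pairwise nonintersecting directed arcs is recorded by its combinatorics: the cusp at
  which each arc end lies, and a number \<open>end_pos\<close> for each end whose values order the ends at every
  cusp, smaller ends being to the right when one looks from the cusp into the surface.
\<close>

record ('a, 'c) arc_system =
  arcs :: "'a set"
  cusps :: "'c set"
  cusp_of :: "'a arc_end \<Rightarrow> 'c"
  end_pos :: "'a arc_end \<Rightarrow> nat"

definition arc_ends :: "('a, 'c) arc_system \<Rightarrow> 'a arc_end set" where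
  "arc_ends S = Src ` arcs S \<union> Tgt ` arcs S"

definition leftmost_end :: "('a, 'c) arc_system \<Rightarrow> 'a arc_end \<Rightarrow> bool" where
  "leftmost_end S x \<longleftrightarrow> x \<in> arc_ends S \<and>
     (\<forall>y\<in>arc_ends S. cusp_of S y = cusp_of S x \<longrightarrow> end_pos S y \<le> end_pos S x)"

definition rightmost_end :: "('a, 'c) arc_system \<Rightarrow> 'a arc_end \<Rightarrow> bool" where
  "rightmost_end S x \<longleftrightarrow> x \<in> arc_ends S \<and>
     (\<forall>y\<in>arc_ends S. cusp_of S y = cusp_of S x \<longrightarrow> end_pos S x \<le> end_pos S y)"

text \<open>\<open>right_neighbour S x y\<close>: the end \<open>y\<close> is the next one to the right of \<open>x\<close> at the cusp of \<open>x\<close>.\<close>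

definition right_neighbour :: "('a, 'c) arc_system \<Rightarrow> 'a arc_end \<Rightarrow> 'a arc_end \<Rightarrow> bool" where
  "right_neighbour S x y \<longleftrightarrow> x \<in> arc_ends S \<and> y \<in> arc_ends S \<and>
     cusp_of S x = cusp_of S y \<and> end_pos S y < end_pos S x \<and>
     \<not> (\<exists>z\<in>arc_ends S. cusp_of S z = cusp_of S x \<and>
          end_pos S y < end_pos S z \<and> end_pos S z < end_pos S x)"

text \<open>
  An end \<open>x\<close> also stands for the arc traversed starting from \<open>x\<close>. Suppose one walks along it with a
  hole on the left. At the arrival end, seen from the cusp, the hole is on the right: the walk along
  the hole goes on with the right neighbour of the arrival end or, if there is none, it passes the
  cusp itself and goes on with the leftmost end. The holes are the orbits of this successor
  relation, which is the graph of a permutation of the ends, so that its reflexive transitive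
  closure is symmetric. The disc with one cusp has no arcs, hence no orbit, but one hole.
\<close>

definition hole_step :: "('a, 'c) arc_system \<Rightarrow> ('a arc_end \<times> 'a arc_end) set" where
  "hole_step S = {(x, y). x \<in> arc_ends S \<and>
     (right_neighbour S (other_end x) y \<or>
      rightmost_end S (other_end x) \<and> leftmost_end S y \<and>
        cusp_of S y = cusp_of S (other_end x))}"

definition num_holes :: "('a, 'c) arc_system \<Rightarrow> nat" where
  "num_holes S = (if arcs S = {} then 1 else card (arc_ends S // (hole_step S)\<^sup>*))"

text \<open>
  Complete systems of arcs on \<open>\<Sigma>\<^bsub>g,s,n\<^esub>\<close>: the cusps and arcs form a connected ribbon graph onto
  which the surface retracts, so the arcs freely generate the fundamental groupoid based at the
  cusps. The last conjunct says that the Euler characteristic \<open>card (cusps S) - card (arcs S)\<close> is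
  \<open>2 - 2 * g - s\<close>.
\<close>

definition complete_arc_system ::
    "nat \<Rightarrow> nat \<Rightarrow> nat \<Rightarrow> ('a, 'c) arc_system \<Rightarrow> bool" where
  "complete_arc_system g s n S \<longleftrightarrow>
     finite (arcs S) \<and> finite (cusps S) \<and> card (cusps S) = n \<and> n \<ge> 1 \<and>
     cusp_of S ` arc_ends S \<subseteq> cusps S \<and>
     (\<forall>x\<in>arc_ends S. \<forall>y\<in>arc_ends S.
        cusp_of S x = cusp_of S y \<and> end_pos S x = end_pos S y \<longrightarrow> x = y) \<and>
     (\<forall>a\<in>arcs S. cusp_of S (Src a) = cusp_of S (Tgt a) \<longrightarrow> end_pos S (Tgt a) < end_pos S (Src a)) \<and>
     (\<forall>c\<in>cusps S. \<forall>d\<in>cusps S.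
        (c, d) \<in> {(cusp_of S x, cusp_of S (other_end x)) | x. x \<in> arc_ends S}\<^sup>*) \<and>
     num_holes S = s \<and>
     card (arcs S) + 2 = 2 * g + s + n"

text \<open>
  The path along a hole from one cusp to the next one, with the hole on its left, as the list of
  the ends from which the successive arcs are traversed: it starts from the leftmost end at its first
  cusp, turns right as sharply as possible whenever the cusp it reaches is not on that side, and
  stops as soon as it arrives at a rightmost end.
\<close>

definition boundary_path :: "('a, 'c) arc_system \<Rightarrow> 'a arc_end list \<Rightarrow> bool" where
  "boundary_path S xs \<longleftrightarrow> xs \<noteq> [] \<and> set xs \<subseteq> arc_ends S \<and>
     leftmost_end S (hd xs) \<and>
     (\<forall>i. Suc i < length xs \<longrightarrow> right_neighbour S (other_end (xs ! i)) (xs ! Suc i)) \<and>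
     rightmost_end S (other_end (last xs))"


section \<open>Monodromy matrices\<close>

text \<open>Polynomials in the variables \<open>(a, i, j)\<close>, the entries of the monodromy datum of the arc \<open>a\<close>.
  Matrix indices start at 0.\<close>

type_synonym 'a entry_poly = "('a \<times> nat \<times> nat \<Rightarrow>\<^sub>0 nat) \<Rightarrow>\<^sub>0 complex"

definition const_poly :: "complex \<Rightarrow> 'a entry_poly" where
  "const_poly c = Poly_Mapping.single 0 c"

definition entry_var :: "'a \<times> nat \<times> nat \<Rightarrow> 'a entry_poly" where
  "entry_var v = Poly_Mapping.single (Poly_Mapping.single v 1) 1"

definition entry_vars :: "('a, 'c) arc_system \<Rightarrow> nat \<Rightarrow> ('a \<times> nat \<times> nat) set" where
  "entry_vars S k = arcs S \<times> {..<k} \<times> {..<k}"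

definition mono_mat :: "nat \<Rightarrow> 'a \<Rightarrow> 'a entry_poly mat" where
  "mono_mat k a = mat k k (\<lambda>(i, j). entry_var (a, i, j))"

text \<open>The regular functions on \<open>SL\<^sub>k\<close>-valued monodromy data are \<open>entry_algebra S k\<close> modulo the ideal
  generated by \<open>sl_relations S k\<close>.\<close>

inductive_set entry_algebra :: "('a, 'c) arc_system \<Rightarrow> nat \<Rightarrow> 'a entry_poly set"
  for S :: "('a, 'c) arc_system" and k :: nat where
  const: "const_poly c \<in> entry_algebra S k"
| var: "v \<in> entry_vars S k \<Longrightarrow> entry_var v \<in> entry_algebra S k"
| add: "f \<in> entry_algebra S k \<Longrightarrow> h \<in> entry_algebra S k \<Longrightarrow> f + h \<in> entry_algebra S k"
| mult: "f \<in> entry_algebra S k \<Longrightarrow> h \<in> entry_algebra S k \<Longrightarrow> f * h \<in> entry_algebra S k"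

definition sl_relations :: "('a, 'c) arc_system \<Rightarrow> nat \<Rightarrow> 'a entry_poly set" where
  "sl_relations S k = {det (mono_mat k a) - 1 | a. a \<in> arcs S}"

text \<open>On \<open>SL\<^sub>k\<close> the inverse matrix is the adjugate.\<close>

fun end_mat :: "nat \<Rightarrow> 'a arc_end \<Rightarrow> 'a entry_poly mat" where
  "end_mat k (Src a) = mono_mat k a"
| "end_mat k (Tgt a) = adj_mat (mono_mat k a)"

fun path_mat :: "nat \<Rightarrow> 'a arc_end list \<Rightarrow> 'a entry_poly mat" where
  "path_mat k [] = 1\<^sub>m k"
| "path_mat k (x # xs) = path_mat k xs * end_mat k x"


section \<open>The Poisson bracket\<close>

text \<open>\<open>Mat\<^sub>k \<otimes> Mat\<^sub>k\<close> is realised by \<open>k\<^sup>2 \<times> k\<^sup>2\<close> matrices: the coefficient of \<open>e\<^bsub>ij\<^esub> \<otimes> e\<^bsub>pq\<^esub>\<close> is the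
  entry at \<open>(i * k + p, j * k + q)\<close>.\<close>

definition kronecker :: "'r :: times mat \<Rightarrow> 'r mat \<Rightarrow> 'r mat" where
  "kronecker A B = mat (dim_row A * dim_row B) (dim_col A * dim_col B)
     (\<lambda>(u, v). A $$ (u div dim_row B, v div dim_col B) * B $$ (u mod dim_row B, v mod dim_col B))"

definition leg1 :: "nat \<Rightarrow> 'r :: comm_ring_1 mat \<Rightarrow> 'r mat" where
  "leg1 k A = kronecker A (1\<^sub>m k)"

definition leg2 :: "nat \<Rightarrow> 'r :: comm_ring_1 mat \<Rightarrow> 'r mat" where
  "leg2 k A = kronecker (1\<^sub>m k) A"

definition r_mat :: "nat \<Rightarrow> complex mat" where
  "r_mat k = mat (k * k) (k * k) (\<lambda>(u, v).
     let i = u div k; p = u mod k; j = v div k; q = v mod k in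
       (if i = j \<and> p = q then 1 / 2 else 0)
       - (if i = j \<and> p = q \<and> i = p then 1 else 0)
       - (if i < j \<and> p = j \<and> q = i then 2 else 0))"

abbreviation rp :: "nat \<Rightarrow> 'a entry_poly mat" where
  "rp k \<equiv> map_mat const_poly (r_mat k)"

abbreviation rpT :: "nat \<Rightarrow> 'a entry_poly mat" where
  "rpT k \<equiv> transpose_mat (rp k)"

definition M1 :: "nat \<Rightarrow> 'a \<Rightarrow> 'a entry_poly mat" where "M1 k a = leg1 k (mono_mat k a)"

definition M2 :: "nat \<Rightarrow> 'a \<Rightarrow> 'a entry_poly mat" where "M2 k a = leg2 k (mono_mat k a)"

fun end_contrib :: "('a, 'c) arc_system \<Rightarrow> nat \<Rightarrow> 'a arc_end \<Rightarrow> 'a arc_end \<Rightarrow> 'a entry_poly mat" where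
  "end_contrib S k (Src a) (Src b) =
     (if cusp_of S (Src a) \<noteq> cusp_of S (Src b) then 0\<^sub>m (k * k) (k * k)
      else if end_pos S (Src a) < end_pos S (Src b) then M1 k a * M2 k b * rp k
      else - (M1 k a * M2 k b * rpT k))"
| "end_contrib S k (Tgt a) (Tgt b) =
     (if cusp_of S (Tgt a) \<noteq> cusp_of S (Tgt b) then 0\<^sub>m (k * k) (k * k)
      else if end_pos S (Tgt a) < end_pos S (Tgt b) then rp k * M1 k a * M2 k b
      else - (rpT k * M1 k a * M2 k b))"
| "end_contrib S k (Src a) (Tgt b) =
     (if cusp_of S (Src a) \<noteq> cusp_of S (Tgt b) then 0\<^sub>m (k * k) (k * k)
      else if end_pos S (Src a) < end_pos S (Tgt b) then - (M1 k a * rp k * M2 k b)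
      else M1 k a * rpT k * M2 k b)"
| "end_contrib S k (Tgt a) (Src b) =
     (if cusp_of S (Tgt a) \<noteq> cusp_of S (Src b) then 0\<^sub>m (k * k) (k * k)
      else if end_pos S (Tgt a) < end_pos S (Src b) then - (M2 k b * rp k * M1 k a)
      else M2 k b * rpT k * M1 k a)"

definition arc_bracket :: "('a, 'c) arc_system \<Rightarrow> nat \<Rightarrow> 'a \<Rightarrow> 'a \<Rightarrow> 'a entry_poly mat" where
  "arc_bracket S k a b =
     (if a \<noteq> b then
        end_contrib S k (Src a) (Src b) + end_contrib S k (Tgt a) (Tgt b)
        + end_contrib S k (Src a) (Tgt b) + end_contrib S k (Tgt a) (Src b)
      else if cusp_of S (Src a) \<noteq> cusp_of S (Tgt a) then
        M1 k a * M2 k a * rp k - rpT k * M1 k a * M2 k a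
      else
        M1 k a * rpT k * M2 k a - rpT k * M1 k a * M2 k a
        + M2 k a * M1 k a * rp k - M2 k a * rp k * M1 k a)"

fun var_bracket ::
    "('a, 'c) arc_system \<Rightarrow> nat \<Rightarrow> 'a \<times> nat \<times> nat \<Rightarrow> 'a \<times> nat \<times> nat \<Rightarrow> 'a entry_poly" where
  "var_bracket S k (a, i, j) (b, p, q) = arc_bracket S k a b $$ (i * k + p, j * k + q)"

definition partial_deriv :: "'a \<times> nat \<times> nat \<Rightarrow> 'a entry_poly \<Rightarrow> 'a entry_poly" where
  "partial_deriv v f = (\<Sum>m\<in>Poly_Mapping.keys f.
     Poly_Mapping.single (m - Poly_Mapping.single v 1)
       (of_nat (Poly_Mapping.lookup m v) * Poly_Mapping.lookup f m))"

text \<open>The extension of the brackets of the matrix entries to polynomials by the Leibniz rule.\<close>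

definition poisson_bracket ::
    "('a, 'c) arc_system \<Rightarrow> nat \<Rightarrow> 'a entry_poly \<Rightarrow> 'a entry_poly \<Rightarrow> 'a entry_poly" where
  "poisson_bracket S k f h = (\<Sum>v\<in>entry_vars S k. \<Sum>w\<in>entry_vars S k.
     partial_deriv v f * partial_deriv w h * var_bracket S k v w)"


section \<open>Poisson reductions\<close>

inductive_set gen_ideal :: "'r :: comm_ring_1 set \<Rightarrow> 'r set \<Rightarrow> 'r set"
  for A E :: "'r :: comm_ring_1 set" where
  zero: "0 \<in> gen_ideal A E"
| step: "c \<in> A \<Longrightarrow> e \<in> E \<Longrightarrow> h \<in> gen_ideal A E \<Longrightarrow> c * e + h \<in> gen_ideal A E"

text \<open>
  The functions in \<open>E\<close> may be set to zero: the brackets of all elements of the ideal generated by \<open>E\<close>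
  with all elements of the algebra lie in the ideal generated by \<open>E\<close> in the coordinate ring of
  \<open>SL\<^sub>k\<close>-valued data. The bracket is computed on polynomial representatives and the result is
  compared modulo \<open>sl_relations\<close>, because with this \<open>r\<close> a determinant has bracket
  \<open>\<plusminus> (k / 2 - 1) * det A * B\<close> with the datum \<open>B\<close> of another arc sharing just one cusp, so that for
  \<open>k \<noteq> 2\<close> the relations \<open>det = 1\<close> alone do not generate a Poisson ideal.
\<close>

definition poisson_reduction :: "('a, 'c) arc_system \<Rightarrow> nat \<Rightarrow> 'a entry_poly set \<Rightarrow> bool" where
  "poisson_reduction S k E \<longleftrightarrow>
     (\<forall>h\<in>gen_ideal (entry_algebra S k) E. \<forall>f\<in>entry_algebra S k.
        poisson_bracket S k h f \<in> gen_ideal (entry_algebra S k) (E \<union> sl_relations S k))"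

text \<open>The entries below the main anti-diagonal; for indices starting at 1 the condition
  reads \<open>i + j \<ge> k + 2\<close>.\<close>

definition below_antidiag :: "nat \<Rightarrow> 'r mat \<Rightarrow> 'r set" where
  "below_antidiag k M = {M $$ (i, j) | i j. i < k \<and> j < k \<and> (i + 1) + (j + 1) \<ge> k + 2}"

end

theory Submission
  imports Defs
begin

text \<open>
  Fix an arc \<open>b\<close> and one entry \<open>B\<^bsub>pq\<^esub>\<close> of its datum. The bracket with \<open>B\<^bsub>pq\<^esub>\<close> is a derivation \<open>D\<close>, and on
  the datum \<open>A\<close> of an arc the Fock-Rosly relations take the form \<open>D A = A * U - V * A\<close>. The
  \<open>k \<times> k\<close> matrices \<open>U\<close> and \<open>V\<close> belong to the source and the target of the arc: each is a sum over the
  ends of \<open>b\<close> at the same cusp, and a summand depends only on that end of \<open>b\<close> and on the side of it on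
  which the end of the arc lies. The bracket of an arc with itself fits this pattern too, in two
  ways, because \<open>r + r\<^sup>T = 1 - 2 P\<close>, where the flip \<open>P\<close> commutes with \<open>A \<otimes> A\<close> (\<open>slice_arc_bracket\<close>).

  For an arc traversed backwards the derivation of \<open>A * adj A = det A\<close> gives the same pattern for
  \<open>adj A\<close>, modulo \<open>det A = 1\<close> and up to a scalar multiple of \<open>adj A\<close> (\<open>bracket_end_mat\<close>). Along a path
  whose consecutive arc ends are neighbours at their cusp the formulas telescope, because \<open>b\<close> has no
  end between two neighbours. Hence also \<open>D X = c * X + X * U - V * X\<close> for the matrix \<open>X\<close> of a path,
  with \<open>U\<close> from its first end and \<open>V\<close> from its last end (\<open>bracket_path_mat\<close>). This also covers the
  case in which the path runs through \<open>b\<close>, even in both directions.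

  If the path follows the boundary of a hole, its first end is leftmost, so that \<open>U\<close> is built from
  \<open>r\<^sup>T\<close> only and is lower triangular, and its last end is rightmost, so that \<open>V\<close> is built from \<open>r\<close> only
  and is upper triangular. Thus \<open>X * U\<close> moves columns of \<open>X\<close> to the left and \<open>V * X\<close> moves rows up, and
  if the entries of \<open>X\<close> below the main antidiagonal vanish, then so do those of \<open>D X\<close>.
\<close>

section \<open>The bracket as a biderivation\<close>

lemma partial_deriv_superset:
  assumes "finite F" "Poly_Mapping.keys f \<subseteq> F"
  shows "partial_deriv v f = (\<Sum>m\<in>F. Poly_Mapping.single (m - Poly_Mapping.single v 1)
           (of_nat (Poly_Mapping.lookup m v) * Poly_Mapping.lookup f m))"
  unfolding partial_deriv_def
  by (rule sum.mono_neutral_left) (use assms in \<open>auto simp: in_keys_iff\<close>)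

lemma partial_deriv_add: "partial_deriv v (f + h) = partial_deriv v f + partial_deriv v h"
proof -
  let ?F = "Poly_Mapping.keys f \<union> Poly_Mapping.keys h"
  have "Poly_Mapping.keys (f + h) \<subseteq> ?F"
    by (rule Poly_Mapping.keys_add)
  then show ?thesis
    by (simp add: partial_deriv_superset[of ?F] lookup_add distrib_left single_add sum.distrib)
qed

lemma partial_deriv_zero: "partial_deriv v 0 = 0"
  by (simp add: partial_deriv_def)

lemma partial_deriv_sum: "partial_deriv v (\<Sum>x\<in>X. f x) = (\<Sum>x\<in>X. partial_deriv v (f x))"
  by (induction X rule: infinite_finite_induct) (simp_all add: partial_deriv_add partial_deriv_zero)

lemma partial_deriv_single:
  "partial_deriv v (Poly_Mapping.single m c) =
     Poly_Mapping.single (m - Poly_Mapping.single v 1) (of_nat (Poly_Mapping.lookup m v) * c)"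
  by (subst partial_deriv_superset[of "{m}"]) auto

lemma partial_deriv_const: "partial_deriv v (const_poly c) = 0"
  by (simp add: const_poly_def partial_deriv_single)

lemma partial_deriv_var: "partial_deriv v (entry_var w) = (if v = w then 1 else 0)"
  by (auto simp: entry_var_def partial_deriv_single lookup_single when_def)

lemma poly_mapping_sum_single:
  "f = (\<Sum>m\<in>Poly_Mapping.keys f. Poly_Mapping.single m (Poly_Mapping.lookup f m))"
  by (rule poly_mapping_eqI) (auto simp: lookup_sum lookup_single when_def in_keys_iff)

text \<open>The Leibniz rule on monomials. Truncated subtraction of exponents is harmless: where it
  truncates, the exponent of the variable is 0, and so is the coefficient.\<close>

lemma partial_deriv_single_mult:
  "partial_deriv v (Poly_Mapping.single m c * Poly_Mapping.single n d) =
     partial_deriv v (Poly_Mapping.single m c) * Poly_Mapping.single n d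
     + Poly_Mapping.single m c * partial_deriv v (Poly_Mapping.single n d)"
proof -
  let ?e = "Poly_Mapping.single v (1::nat)"
  have shift: "a + b - ?e = a - ?e + b" if "Poly_Mapping.lookup a v \<noteq> 0" for a b :: "_ \<Rightarrow>\<^sub>0 nat"
    using that by (intro poly_mapping_eqI) (auto simp: lookup_add lookup_minus lookup_single when_def)
  have "Poly_Mapping.single (m + n - ?e) (of_nat (Poly_Mapping.lookup m v) * c * d) =
      Poly_Mapping.single (m - ?e + n) (of_nat (Poly_Mapping.lookup m v) * c * d)"
    using shift[of m n] by (cases "Poly_Mapping.lookup m v = 0") auto
  moreover have "Poly_Mapping.single (m + n - ?e) (c * (of_nat (Poly_Mapping.lookup n v) * d)) =
      Poly_Mapping.single (m + (n - ?e)) (c * (of_nat (Poly_Mapping.lookup n v) * d))"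
    using shift[of n m] by (cases "Poly_Mapping.lookup n v = 0") (auto simp: add.commute)
  moreover have "of_nat (Poly_Mapping.lookup (m + n) v) * (c * d) =
      of_nat (Poly_Mapping.lookup m v) * c * d + c * (of_nat (Poly_Mapping.lookup n v) * d)"
    by (simp add: lookup_add algebra_simps)
  ultimately show ?thesis
    by (simp only: mult_single partial_deriv_single single_add)
qed

lemma partial_deriv_mult:
  "partial_deriv v (f * h) = partial_deriv v f * h + f * partial_deriv v h"
proof -
  have single: "partial_deriv v (Poly_Mapping.single m c * h) =
      partial_deriv v (Poly_Mapping.single m c) * h + Poly_Mapping.single m c * partial_deriv v h"
    for m c
    by (subst (1 2 3) poly_mapping_sum_single[of h])
      (simp add: sum_distrib_left partial_deriv_sum partial_deriv_single_mult sum.distrib)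
  show ?thesis
    by (subst (1 2 3) poly_mapping_sum_single[of f])
      (simp add: sum_distrib_right partial_deriv_sum single sum.distrib)
qed

lemma poisson_bracket_add_left:
  "poisson_bracket S k (f + f') h = poisson_bracket S k f h + poisson_bracket S k f' h"
  by (simp add: poisson_bracket_def partial_deriv_add distrib_left distrib_right sum.distrib)

lemma poisson_bracket_add_right:
  "poisson_bracket S k f (h + h') = poisson_bracket S k f h + poisson_bracket S k f h'"
  by (simp add: poisson_bracket_def partial_deriv_add distrib_left distrib_right sum.distrib)

lemma poisson_bracket_mult_left:
  "poisson_bracket S k (f * f') h = poisson_bracket S k f h * f' + f * poisson_bracket S k f' h"
  unfolding poisson_bracket_def sum_distrib_left sum_distrib_right sum.distrib[symmetric]
  by (intro sum.cong refl) (simp add: partial_deriv_mult algebra_simps)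

lemma poisson_bracket_mult_right:
  "poisson_bracket S k f (h * h') = poisson_bracket S k f h * h' + h * poisson_bracket S k f h'"
  unfolding poisson_bracket_def sum_distrib_left sum_distrib_right sum.distrib[symmetric]
  by (intro sum.cong refl) (simp add: partial_deriv_mult algebra_simps)

lemma poisson_bracket_const:
  "poisson_bracket S k (const_poly c) h = 0" "poisson_bracket S k f (const_poly c) = 0"
  by (simp_all add: poisson_bracket_def partial_deriv_const)

lemma poisson_bracket_zero: "poisson_bracket S k 0 h = 0"
  by (simp add: poisson_bracket_def partial_deriv_zero)

lemma poisson_bracket_var:
  assumes "finite (arcs S)" "v \<in> entry_vars S k" "w \<in> entry_vars S k"
  shows "poisson_bracket S k (entry_var v) (entry_var w) = var_bracket S k v w"
proof -
  have fin: "finite (entry_vars S k)"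
    using assms(1) by (simp add: entry_vars_def)
  have "poisson_bracket S k (entry_var v) (entry_var w) =
      (\<Sum>v'\<in>entry_vars S k. if v' = v then
         (\<Sum>w'\<in>entry_vars S k. if w' = w then var_bracket S k v' w' else 0) else 0)"
    unfolding poisson_bracket_def
    by (intro sum.cong refl) (auto simp: partial_deriv_var intro!: sum.cong)
  then show ?thesis
    using assms fin by (simp add: sum.delta)
qed

section \<open>The entry algebra and its ideals\<close>

lemma const_poly_simps:
  "const_poly 0 = 0" "const_poly 1 = 1" "const_poly (c + d) = const_poly c + const_poly d"
  "const_poly (- c) = - const_poly c" "const_poly (c - d) = const_poly c - const_poly d"
  by (simp_all add: const_poly_def single_add single_uminus single_diff)

lemma entry_algebra_0: "0 \<in> entry_algebra S k"
  using entry_algebra.const[of 0] by (simp add: const_poly_simps)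

lemma entry_algebra_1: "1 \<in> entry_algebra S k"
  using entry_algebra.const[of 1] by (simp add: const_poly_simps)

lemma entry_algebra_uminus: "f \<in> entry_algebra S k \<Longrightarrow> - f \<in> entry_algebra S k"
  using entry_algebra.mult[OF entry_algebra.const[of "- 1"], of f S k] by (simp add: const_poly_simps)

lemma entry_algebra_minus:
  "f \<in> entry_algebra S k \<Longrightarrow> h \<in> entry_algebra S k \<Longrightarrow> f - h \<in> entry_algebra S k"
  using entry_algebra.add[OF _ entry_algebra_uminus] by (metis diff_conv_add_uminus)

lemma entry_algebra_sum:
  "(\<And>x. x \<in> X \<Longrightarrow> f x \<in> entry_algebra S k) \<Longrightarrow> (\<Sum>x\<in>X. f x) \<in> entry_algebra S k"
  by (induction X rule: infinite_finite_induct) (auto intro: entry_algebra_0 entry_algebra.add)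

lemma entry_algebra_prod:
  "(\<And>x. x \<in> X \<Longrightarrow> f x \<in> entry_algebra S k) \<Longrightarrow> (\<Prod>x\<in>X. f x) \<in> entry_algebra S k"
  by (induction X rule: infinite_finite_induct) (auto intro: entry_algebra_1 entry_algebra.mult)

lemma entry_algebra_sign: "(- 1) ^ n \<in> entry_algebra S k"
  by (induction n) (auto intro: entry_algebra_1 entry_algebra_uminus)

lemma entry_algebra_signof: "signof \<pi> \<in> entry_algebra S k"
  by (auto simp: sign_def intro: entry_algebra_1 entry_algebra_uminus)

lemma gen_ideal_add:
  "f \<in> gen_ideal A E \<Longrightarrow> h \<in> gen_ideal A E \<Longrightarrow> f + h \<in> gen_ideal A E"
  by (induction rule: gen_ideal.induct) (auto simp: add.assoc intro: gen_ideal.step)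

lemma gen_ideal_generator: "c \<in> A \<Longrightarrow> e \<in> E \<Longrightarrow> c * e \<in> gen_ideal A E"
  using gen_ideal.step[OF _ _ gen_ideal.zero] by fastforce

lemma gen_ideal_mult:
  assumes "c \<in> entry_algebra S k" "h \<in> gen_ideal (entry_algebra S k) E"
  shows "c * h \<in> gen_ideal (entry_algebra S k) E"
  using assms(2)
proof induction
  case (step d e h)
  have "(c * d) * e + c * h \<in> gen_ideal (entry_algebra S k) E"
    using step assms(1) by (intro gen_ideal.step entry_algebra.mult)
  then show ?case
    by (simp add: algebra_simps)
qed (simp add: gen_ideal.zero)

lemma gen_ideal_sum:
  "(\<And>x. x \<in> X \<Longrightarrow> f x \<in> gen_ideal A E) \<Longrightarrow> (\<Sum>x\<in>X. f x) \<in> gen_ideal A E"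
  by (induction X rule: infinite_finite_induct) (auto intro: gen_ideal.zero gen_ideal_add)

section \<open>Matrices with entries in the algebra\<close>

text \<open>With \<open>A\<close> the entry algebra these matrices form a ring, and with \<open>A\<close> an ideal of the entry
  algebra they form a two-sided ideal of that ring. Tracking the subring is necessary because
  \<open>gen_ideal\<close> admits only coefficients from it.\<close>

definition mats_over :: "'r set \<Rightarrow> nat \<Rightarrow> 'r mat set" where
  "mats_over A k = {M \<in> carrier_mat k k. \<forall>i<k. \<forall>j<k. M $$ (i, j) \<in> A}"

lemma mats_overI: "M \<in> carrier_mat k k \<Longrightarrow> (\<And>i j. i < k \<Longrightarrow> j < k \<Longrightarrow> M $$ (i, j) \<in> A) \<Longrightarrow> M \<in> mats_over A k"
  by (simp add: mats_over_def)

lemma mats_over_carrier: "M \<in> mats_over A k \<Longrightarrow> M \<in> carrier_mat k k"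
  by (simp add: mats_over_def)

lemma mats_over_entry: "M \<in> mats_over A k \<Longrightarrow> i < k \<Longrightarrow> j < k \<Longrightarrow> M $$ (i, j) \<in> A"
  by (simp add: mats_over_def)

lemma index_mult_mat_sum:
  assumes "M \<in> carrier_mat n m" "N \<in> carrier_mat m l" "i < n" "j < l"
  shows "(M * N) $$ (i, j) = (\<Sum>s<m. M $$ (i, s) * N $$ (s, j))"
  using assms by (simp add: scalar_prod_def atLeast0LessThan)

lemma mats_over_mult:
  assumes "M \<in> mats_over (entry_algebra S k) n" "N \<in> mats_over (entry_algebra S k) n"
  shows "M * N \<in> mats_over (entry_algebra S k) n"
  using assms mats_over_carrier[OF assms(1)] mats_over_carrier[OF assms(2)]
  by (intro mats_overI)
    (auto simp: index_mult_mat_sum simp del: index_mult_mat(1)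
      intro!: entry_algebra_sum entry_algebra.mult dest: mats_over_entry)

lemma mats_over_ideal_mult_left:
  assumes "M \<in> mats_over (entry_algebra S k) n"
    and "N \<in> mats_over (gen_ideal (entry_algebra S k) E) n"
  shows "M * N \<in> mats_over (gen_ideal (entry_algebra S k) E) n"
  using assms mats_over_carrier[OF assms(1)] mats_over_carrier[OF assms(2)]
  by (intro mats_overI)
    (auto simp: index_mult_mat_sum simp del: index_mult_mat(1)
      intro!: gen_ideal_sum gen_ideal_mult dest: mats_over_entry)

lemma mats_over_ideal_mult_right:
  assumes "M \<in> mats_over (entry_algebra S k) n"
    and "N \<in> mats_over (gen_ideal (entry_algebra S k) E) n"
  shows "N * M \<in> mats_over (gen_ideal (entry_algebra S k) E) n"
proof (rule mats_overI)
  note carr = mats_over_carrier[OF assms(1)] mats_over_carrier[OF assms(2)]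
  show "N * M \<in> carrier_mat n n"
    using carr by simp
  show "(N * M) $$ (i, j) \<in> gen_ideal (entry_algebra S k) E" if "i < n" "j < n" for i j
    using that carr assms
    by (auto simp: index_mult_mat_sum mult.commute[of "N $$ _"] simp del: index_mult_mat(1)
        intro!: gen_ideal_sum gen_ideal_mult dest: mats_over_entry)
qed

lemma mats_over_ideal_add:
  assumes "M \<in> mats_over (gen_ideal A E) n" "N \<in> mats_over (gen_ideal A E) n"
  shows "M + N \<in> mats_over (gen_ideal A E) n"
  using assms mats_over_carrier[OF assms(1)] mats_over_carrier[OF assms(2)]
  by (intro mats_overI) (auto intro!: gen_ideal_add dest: mats_over_entry)

lemma mats_over_add:
  assumes "M \<in> mats_over (entry_algebra S k) n" "N \<in> mats_over (entry_algebra S k) n"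
  shows "M + N \<in> mats_over (entry_algebra S k) n"
  using assms mats_over_carrier[OF assms(1)] mats_over_carrier[OF assms(2)]
  by (intro mats_overI) (auto intro!: entry_algebra.add dest: mats_over_entry)

lemma mats_over_minus:
  assumes "M \<in> mats_over (entry_algebra S k) n" "N \<in> mats_over (entry_algebra S k) n"
  shows "M - N \<in> mats_over (entry_algebra S k) n"
  using assms mats_over_carrier[OF assms(1)] mats_over_carrier[OF assms(2)]
  by (intro mats_overI) (auto intro!: entry_algebra_minus dest: mats_over_entry)

lemma mats_over_one: "1\<^sub>m n \<in> mats_over (entry_algebra S k) n"
  by (auto simp: mats_over_def intro: entry_algebra_0 entry_algebra_1)

lemma det_in_entry_algebra:
  assumes "M \<in> mats_over (entry_algebra S k) n"
  shows "det M \<in> entry_algebra S k"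
  unfolding det_def'[OF mats_over_carrier[OF assms]]
proof (intro entry_algebra_sum entry_algebra.mult entry_algebra_signof entry_algebra_prod)
  fix \<pi> i assume "\<pi> \<in> {\<pi>. \<pi> permutes {0..<n}}" and "i \<in> {0..<n}"
  then show "M $$ (i, \<pi> i) \<in> entry_algebra S k"
    using permutes_in_image[of \<pi> "{0..<n}" i] by (intro mats_over_entry[OF assms]) auto
qed

lemma adj_mat_in_entry_algebra:
  assumes "M \<in> mats_over (entry_algebra S k) n"
  shows "adj_mat M \<in> mats_over (entry_algebra S k) n"
proof (rule mats_overI)
  have carr: "M \<in> carrier_mat n n"
    using assms by (rule mats_over_carrier)
  then show "adj_mat M \<in> carrier_mat n n"
    by (rule adj_mat)
  fix i j assume ij: "i < n" "j < n"
  have "mat_delete M j i \<in> mats_over (entry_algebra S k) (n - 1)"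
    using carr assms ij by (auto simp: mat_delete_def mats_over_def)
  then show "adj_mat M $$ (i, j) \<in> entry_algebra S k"
    using carr ij unfolding adj_mat_def cofactor_def
    by (auto intro!: entry_algebra.mult entry_algebra_sign det_in_entry_algebra)
qed

lemma mono_mat_in_entry_algebra: "a \<in> arcs S \<Longrightarrow> mono_mat k a \<in> mats_over (entry_algebra S k) k"
  by (auto simp: mono_mat_def mats_over_def entry_vars_def intro!: entry_algebra.var)

lemma end_mat_in_entry_algebra: "x \<in> arc_ends S \<Longrightarrow> end_mat k x \<in> mats_over (entry_algebra S k) k"
  by (auto simp: arc_ends_def intro!: mono_mat_in_entry_algebra adj_mat_in_entry_algebra)

lemma path_mat_in_entry_algebra:
  "set xs \<subseteq> arc_ends S \<Longrightarrow> path_mat k xs \<in> mats_over (entry_algebra S k) k"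
  by (induction xs) (auto intro!: mats_over_one mats_over_mult end_mat_in_entry_algebra)

section \<open>Slices of tensors\<close>

text \<open>Fixing the row \<open>p\<close> and the column \<open>q\<close> of the second tensor factor turns a bracket
  \<open>{A\<^sub>1, B\<^sub>2}\<close> into the \<open>k \<times> k\<close> matrix of the brackets of the entries of \<open>A\<close> with the single
  function \<open>B\<^bsub>pq\<^esub>\<close>, and multiplication by \<open>A \<otimes> 1\<close> into multiplication by \<open>A\<close>.\<close>

definition slice :: "nat \<Rightarrow> nat \<Rightarrow> nat \<Rightarrow> 'r mat \<Rightarrow> 'r mat" where
  "slice k p q R = mat k k (\<lambda>(i, j). R $$ (i * k + p, j * k + q))"

lemma slice_carrier [simp]: "slice k p q R \<in> carrier_mat k k"
  by (simp add: slice_def)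

lemma tensor_index_less: "i < k \<Longrightarrow> p < k \<Longrightarrow> i * k + p < k * (k::nat)"
  using mult_le_mono1[of "Suc i" k k] by simp

lemma sum_tensor_index: "(\<Sum>u<k * k. f u) = (\<Sum>s<k. \<Sum>t<k. f (s * k + t :: nat))"
proof -
  have "(\<Sum>u<k * k. f u) = (\<Sum>s<k. sum f {s * k..<s * k + k})"
    by (rule sum.nat_group[symmetric])
  also have "\<dots> = (\<Sum>s<k. \<Sum>t<k. f (s * k + t))"
  proof (rule sum.cong[OF refl])
    fix s
    show "sum f {s * k..<s * k + k} = (\<Sum>t<k. f (s * k + t))"
      using sum.shift_bounds_nat_ivl[of f 0 "s * k" k]
      by (simp add: atLeast0LessThan add.commute)
  qed
  finally show ?thesis .
qed

lemma leg_carrier [simp]: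
  assumes "A \<in> carrier_mat k k"
  shows "leg1 k A \<in> carrier_mat (k * k) (k * k)" "leg2 k A \<in> carrier_mat (k * k) (k * k)"
  using assms by (simp_all add: leg1_def leg2_def kronecker_def)

lemma index_leg:
  assumes "A \<in> carrier_mat k k" "i < k" "j < k" "p < k" "q < k"
  shows "leg1 k A $$ (i * k + p, j * k + q) = (if p = q then A $$ (i, j) else 0)"
    and "leg2 k A $$ (i * k + p, j * k + q) = (if i = j then A $$ (p, q) else 0)"
  using assms tensor_index_less[of i k p] tensor_index_less[of j k q]
  by (simp_all add: leg1_def leg2_def kronecker_def div_add1_eq)

lemma index_mult_tensor:
  assumes "R \<in> carrier_mat (k * k) (k * k)" "T \<in> carrier_mat (k * k) (k * k)"
    and "i < k" "j < k" "p < k" "q < k"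
  shows "(R * T) $$ (i * k + p, j * k + q) =
    (\<Sum>s<k. \<Sum>t<k. R $$ (i * k + p, s * k + t) * T $$ (s * k + t, j * k + q))"
  using assms
  by (simp add: index_mult_mat_sum tensor_index_less sum_tensor_index del: index_mult_mat(1))

lemma
  assumes "A \<in> carrier_mat k k" "R \<in> carrier_mat (k * k) (k * k)"
    and "i < k" "j < k" "p < k" "q < k"
  shows index_leg1_mult: "(leg1 k A * R) $$ (i * k + p, j * k + q) =
      (\<Sum>s<k. A $$ (i, s) * R $$ (s * k + p, j * k + q))"
    and index_mult_leg1: "(R * leg1 k A) $$ (i * k + p, j * k + q) =
      (\<Sum>s<k. R $$ (i * k + p, s * k + q) * A $$ (s, j))"
    and index_leg2_mult: "(leg2 k A * R) $$ (i * k + p, j * k + q) =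
      (\<Sum>t<k. A $$ (p, t) * R $$ (i * k + t, j * k + q))"
    and index_mult_leg2: "(R * leg2 k A) $$ (i * k + p, j * k + q) =
      (\<Sum>t<k. R $$ (i * k + p, j * k + t) * A $$ (t, q))"
proof -
  have delta: "(\<Sum>s<k. (if i = s then f s else 0)) = f i" "(\<Sum>s<k. (if s = i then f s else 0)) = f i"
    if "i < k" for i and f :: "nat \<Rightarrow> 'a"
    using that by simp_all
  note simps = index_mult_tensor[OF _ _ assms(3-)] index_leg if_distrib[of "\<lambda>x. x * _"]
    if_distrib[of "\<lambda>x. _ * x"] delta
  show "(leg1 k A * R) $$ (i * k + p, j * k + q) =
      (\<Sum>s<k. A $$ (i, s) * R $$ (s * k + p, j * k + q))"
    using assms by (simp add: simps del: index_mult_mat(1) cong: if_cong)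
  show "(R * leg1 k A) $$ (i * k + p, j * k + q) =
      (\<Sum>s<k. R $$ (i * k + p, s * k + q) * A $$ (s, j))"
    using assms by (simp add: simps del: index_mult_mat(1) cong: if_cong)
  show "(leg2 k A * R) $$ (i * k + p, j * k + q) =
      (\<Sum>t<k. A $$ (p, t) * R $$ (i * k + t, j * k + q))"
    using assms by (subst (1) index_mult_tensor, simp_all add: simps del: index_mult_mat(1) cong: if_cong)
       (subst sum.swap, simp add: simps)
  show "(R * leg2 k A) $$ (i * k + p, j * k + q) =
      (\<Sum>t<k. R $$ (i * k + p, j * k + t) * A $$ (t, q))"
    using assms by (subst (1) index_mult_tensor, simp_all add: simps del: index_mult_mat(1) cong: if_cong)
       (subst sum.swap, simp add: simps)
qed

lemma slice_leg1_mult: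
  assumes "A \<in> carrier_mat k k" "R \<in> carrier_mat (k * k) (k * k)" "p < k" "q < k"
  shows "slice k p q (leg1 k A * R) = A * slice k p q R"
  using assms
  by (intro eq_matI)
    (auto simp: index_leg1_mult index_mult_mat_sum[of _ k k _ k] slice_def simp del: index_mult_mat(1))

lemma slice_mult_leg1:
  assumes "A \<in> carrier_mat k k" "R \<in> carrier_mat (k * k) (k * k)" "p < k" "q < k"
  shows "slice k p q (R * leg1 k A) = slice k p q R * A"
  using assms
  by (intro eq_matI)
    (auto simp: index_mult_leg1 index_mult_mat_sum[of _ k k _ k] slice_def simp del: index_mult_mat(1))

lemma leg1_leg2_commute:
  assumes "A \<in> carrier_mat k k" "B \<in> carrier_mat k k"
  shows "leg1 k A * leg2 k B = leg2 k B * leg1 k A"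
proof (rule eq_matI)
  fix u v assume "u < dim_row (leg2 k B * leg1 k A)" "v < dim_col (leg2 k B * leg1 k A)"
  then have uv: "u < k * k" "v < k * k"
    using leg_carrier[OF assms(1)] leg_carrier[OF assms(2)] by auto
  then have "k > 0"
    by (cases k) auto
  then have lt: "u div k < k" "v div k < k" "u mod k < k" "v mod k < k"
    using uv by (simp_all add: less_mult_imp_div_less)
  have "(leg1 k A * leg2 k B) $$ (i * k + p, j * k + q) = (leg2 k B * leg1 k A) $$ (i * k + p, j * k + q)"
    if "i < k" "j < k" "p < k" "q < k" for i j p q
    using assms that
    by (simp add: index_leg1_mult index_leg2_mult index_leg if_distrib[of "\<lambda>x. _ * x"] mult.commute
        del: index_mult_mat(1) cong: if_cong)
  from this[OF lt] show "(leg1 k A * leg2 k B) $$ (u, v) = (leg2 k B * leg1 k A) $$ (u, v)"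
    by simp
qed (use leg_carrier[OF assms(1)] leg_carrier[OF assms(2)] in auto)

lemma slice_add:
  assumes "R \<in> carrier_mat (k * k) (k * k)" "T \<in> carrier_mat (k * k) (k * k)" "p < k" "q < k"
  shows "slice k p q (R + T) = slice k p q R + slice k p q T"
  using assms by (intro eq_matI) (auto simp: slice_def tensor_index_less)

lemma slice_minus:
  assumes "R \<in> carrier_mat (k * k) (k * k)" "T \<in> carrier_mat (k * k) (k * k)" "p < k" "q < k"
  shows "slice k p q (R - T) = slice k p q R - slice k p q T"
  using assms by (intro eq_matI) (auto simp: slice_def tensor_index_less)

lemma slice_uminus:
  assumes "R \<in> carrier_mat (k * k) (k * k)" "p < k" "q < k"
  shows "slice k p q (- R) = - slice k p q R"
  using assms by (intro eq_matI) (auto simp: slice_def tensor_index_less)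

lemma slice_zero: "p < k \<Longrightarrow> q < k \<Longrightarrow> slice k p q (0\<^sub>m (k * k) (k * k)) = 0\<^sub>m k k"
  by (intro eq_matI) (auto simp: slice_def tensor_index_less)

section \<open>The bracket of an arc with one matrix entry\<close>

lemma square_mult_carrier [simp]:
  "A \<in> carrier_mat n n \<Longrightarrow> B \<in> carrier_mat n n \<Longrightarrow> A * B \<in> carrier_mat n n"
  by (rule mult_carrier_mat)

lemma r_mat_carrier [simp]: "r_mat k \<in> carrier_mat (k * k) (k * k)"
  by (simp add: r_mat_def)

lemma M_carrier [simp]:
  "mono_mat k a \<in> carrier_mat k k"
  "M1 k a \<in> carrier_mat (k * k) (k * k)" "M2 k a \<in> carrier_mat (k * k) (k * k)"
  by (simp_all add: mono_mat_def M1_def M2_def)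

lemma index_rp:
  assumes "i < k" "j < k" "p < k" "q < k"
  shows "rp k $$ (i * k + p, j * k + q) = const_poly
    ((if i = j \<and> p = q then 1 / 2 else 0) - (if i = j \<and> p = q \<and> i = p then 1 else 0)
       - (if i < j \<and> p = j \<and> q = i then 2 else 0))"
  using assms tensor_index_less[of i k p] tensor_index_less[of j k q]
  by (simp add: r_mat_def Let_def)

lemma index_rpT:
  assumes "i < k" "j < k" "p < k" "q < k"
  shows "rpT k $$ (i * k + p, j * k + q) = rp k $$ (j * k + q, i * k + p)"
  using assms tensor_index_less[of i k p] tensor_index_less[of j k q]
  by (intro index_transpose_mat(1)) (simp_all add: r_mat_def)

text \<open>In the first tensor factor \<open>r\<close> moves lower rows up and \<open>r\<^sup>T\<close> moves right columns left. These
  are the directions that keep the triangle below the antidiagonal empty.\<close>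

lemma rp_upper_triangular:
  "j < i \<Longrightarrow> i < k \<Longrightarrow> j < k \<Longrightarrow> p < k \<Longrightarrow> q < k \<Longrightarrow> rp k $$ (i * k + p, j * k + q) = 0"
  by (simp add: index_rp const_poly_simps)

lemma rpT_lower_triangular:
  "i < j \<Longrightarrow> i < k \<Longrightarrow> j < k \<Longrightarrow> p < k \<Longrightarrow> q < k \<Longrightarrow> rpT k $$ (i * k + p, j * k + q) = 0"
  by (simp add: index_rpT rp_upper_triangular)

text \<open>\<open>r + r\<^sup>T\<close> is \<open>1 - 2 P\<close>, where \<open>P\<close> is the flip of the two tensor factors.\<close>

lemma index_rp_add_rpT:
  assumes "i < k" "j < k" "p < k" "q < k"
  shows "rp k $$ (i * k + p, j * k + q) + rpT k $$ (i * k + p, j * k + q) =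
    (if i = j \<and> p = q then 1 else 0) - (if i = q \<and> p = j then const_poly 2 else 0)"
proof -
  have half: "const_poly (1 / 2) + const_poly (1 / 2) = (1 :: 'a entry_poly)"
    and minus_half: "const_poly (- (1 / 2)) + const_poly (- (1 / 2)) = 1 - (const_poly 2 :: 'a entry_poly)"
    unfolding const_poly_simps(2,3,5)[symmetric] by simp_all
  show ?thesis
    using assms half minus_half
    by (cases "i = j"; cases "p = q"; cases "i = q"; cases "p = j")
      (auto simp: index_rpT index_rp const_poly_simps(1,4))
qed

text \<open>
  Every contribution to \<open>{A\<^sub>1, B\<^sub>2}\<close> from an end \<open>v\<close> of the arc of \<open>A\<close> and an end \<open>w\<close> of the arc of \<open>B\<close>,
  restricted to the entry \<open>B\<^bsub>pq\<^esub>\<close>, has the form \<open>A * G\<close> if \<open>v\<close> is a source and \<open>- G * A\<close> if \<open>v\<close> is a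
  target, with the same matrix \<open>G\<close> in both cases. It depends on \<open>w\<close> and on whether \<open>v\<close> lies to the
  right of \<open>w\<close>, which is the last argument below.
\<close>

fun push :: "nat \<Rightarrow> nat \<Rightarrow> nat \<Rightarrow> 'a arc_end \<Rightarrow> bool \<Rightarrow> 'a entry_poly mat" where
  "push k p q (Src b) right =
     (if right then slice k p q (M2 k b * rp k) else - slice k p q (M2 k b * rpT k))"
| "push k p q (Tgt b) right =
     (if right then - slice k p q (rp k * M2 k b) else slice k p q (rpT k * M2 k b))"

definition cusp_push ::
    "('a, 'c) arc_system \<Rightarrow> nat \<Rightarrow> nat \<Rightarrow> nat \<Rightarrow> 'a arc_end \<Rightarrow> 'a arc_end \<Rightarrow> bool \<Rightarrow> 'a entry_poly mat" where
  "cusp_push S k p q v w right = (if cusp_of S v = cusp_of S w then push k p q w right else 0\<^sub>m k k)"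

text \<open>
  The pushes on \<open>v\<close> of both ends of \<open>b\<close>. The relation \<open>rel\<close> is \<open>(<)\<close> or \<open>(\<le>)\<close>; since different ends at a cusp
  have different positions, the choice matters only if \<open>v\<close> itself is an end of \<open>b\<close>, and says on
  which side of itself \<open>v\<close> is regarded to lie.
\<close>

definition total_push ::
    "('a, 'c) arc_system \<Rightarrow> nat \<Rightarrow> nat \<Rightarrow> nat \<Rightarrow> 'a \<Rightarrow> (nat \<Rightarrow> nat \<Rightarrow> bool) \<Rightarrow> 'a arc_end \<Rightarrow> 'a entry_poly mat" where
  "total_push S k p q b rel v =
     cusp_push S k p q v (Src b) (rel (end_pos S v) (end_pos S (Src b)))
     + cusp_push S k p q v (Tgt b) (rel (end_pos S v) (end_pos S (Tgt b)))"

lemma push_carrier [simp]: "push k p q w right \<in> carrier_mat k k"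
  by (cases w) auto

lemma cusp_push_carrier [simp]: "cusp_push S k p q v w right \<in> carrier_mat k k"
  by (simp add: cusp_push_def)

lemma total_push_carrier [simp]: "total_push S k p q b rel v \<in> carrier_mat k k"
  by (simp add: total_push_def)

lemma matrix_dims [simp]:
  "dim_row (slice k p q R) = k" "dim_col (slice k p q R) = k"
  "dim_row (mono_mat k a) = k" "dim_col (mono_mat k a) = k"
  "dim_row (cusp_push S k p q v w right) = k" "dim_col (cusp_push S k p q v w right) = k"
  "dim_row (total_push S k p q b rel v) = k" "dim_col (total_push S k p q b rel v) = k"
  by (simp_all add: slice_def mono_mat_def carrier_matD[OF cusp_push_carrier] carrier_matD[OF total_push_carrier])

lemma slice_M1_mult:
  "p < k \<Longrightarrow> q < k \<Longrightarrow> R \<in> carrier_mat (k * k) (k * k) \<Longrightarrow>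
     slice k p q (M1 k a * R) = mono_mat k a * slice k p q R"
  unfolding M1_def by (rule slice_leg1_mult) auto

lemma slice_mult_M1:
  "p < k \<Longrightarrow> q < k \<Longrightarrow> R \<in> carrier_mat (k * k) (k * k) \<Longrightarrow>
     slice k p q (R * M1 k a) = slice k p q R * mono_mat k a"
  unfolding M1_def by (rule slice_mult_leg1) auto

lemma M1_M2_commute: "M1 k a * M2 k b = M2 k b * M1 k a"
  unfolding M1_def M2_def by (rule leg1_leg2_commute) auto

lemma slice_M1_M2:
  assumes "p < k" "q < k" "R \<in> carrier_mat (k * k) (k * k)"
  shows "slice k p q (M1 k a * M2 k b * R) = mono_mat k a * slice k p q (M2 k b * R)"
    and "slice k p q (R * M1 k a * M2 k b) = slice k p q (R * M2 k b) * mono_mat k a"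
    and "slice k p q (M1 k a * R * M2 k b) = mono_mat k a * slice k p q (R * M2 k b)"
    and "slice k p q (M2 k b * R * M1 k a) = slice k p q (M2 k b * R) * mono_mat k a"
    and "slice k p q (M2 k b * M1 k a * R) = mono_mat k a * slice k p q (M2 k b * R)"
proof -
  note assoc = assoc_mult_mat[of _ "k * k" "k * k" _ "k * k" _ "k * k"]
  show left: "slice k p q (M1 k a * M2 k b * R) = mono_mat k a * slice k p q (M2 k b * R)"
    using assms by (simp add: assoc slice_M1_mult)
  show "slice k p q (M1 k a * R * M2 k b) = mono_mat k a * slice k p q (R * M2 k b)"
    using assms by (simp add: assoc slice_M1_mult)
  show "slice k p q (M2 k b * R * M1 k a) = slice k p q (M2 k b * R) * mono_mat k a"
    using assms by (intro slice_mult_M1) auto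
  show "slice k p q (M2 k b * M1 k a * R) = mono_mat k a * slice k p q (M2 k b * R)"
    using left by (simp add: M1_M2_commute)
  have "R * M1 k a * M2 k b = R * M2 k b * M1 k a"
    using assms(3) assoc[of R "M1 k a" "M2 k b"] assoc[of R "M2 k b" "M1 k a"]
    by (simp add: M1_M2_commute)
  then show "slice k p q (R * M1 k a * M2 k b) = slice k p q (R * M2 k b) * mono_mat k a"
    using assms slice_mult_M1[of p k q "R * M2 k b" a] by simp
qed

lemma end_contrib_carrier [simp]: "end_contrib S k v w \<in> carrier_mat (k * k) (k * k)"
  by (cases v; cases w) auto

lemma slice_end_contrib:
  assumes "p < k" "q < k"
  shows "slice k p q (end_contrib S k (Src a) w) =
      mono_mat k a * cusp_push S k p q (Src a) w (end_pos S (Src a) < end_pos S w)"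
    and "slice k p q (end_contrib S k (Tgt a) w) =
      - (cusp_push S k p q (Tgt a) w (end_pos S (Tgt a) < end_pos S w) * mono_mat k a)"
proof -
  note simps = cusp_push_def slice_zero[OF assms] slice_uminus[OF _ assms] slice_M1_M2[OF assms]
  have minus_zero: "- 0\<^sub>m k k = (0\<^sub>m k k :: 'a entry_poly mat)"
    by (intro eq_matI) auto
  show "slice k p q (end_contrib S k (Src a) w) =
      mono_mat k a * cusp_push S k p q (Src a) w (end_pos S (Src a) < end_pos S w)"
    by (cases w) (simp_all add: simps del: assoc_mult_mat)
  show "slice k p q (end_contrib S k (Tgt a) w) =
      - (cusp_push S k p q (Tgt a) w (end_pos S (Tgt a) < end_pos S w) * mono_mat k a)"
    by (cases w) (simp_all add: simps minus_zero del: assoc_mult_mat)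
qed

lemma slice_arc_bracket_distinct:
  assumes "p < k" "q < k" "a \<noteq> b"
  shows "slice k p q (arc_bracket S k a b) =
    mono_mat k a * total_push S k p q b (<) (Src a) - total_push S k p q b (<) (Tgt a) * mono_mat k a"
proof -
  let ?A = "mono_mat k a"
  have "slice k p q (arc_bracket S k a b) =
      slice k p q (end_contrib S k (Src a) (Src b)) + slice k p q (end_contrib S k (Tgt a) (Tgt b))
      + slice k p q (end_contrib S k (Src a) (Tgt b)) + slice k p q (end_contrib S k (Tgt a) (Src b))"
    using assms by (simp add: arc_bracket_def slice_add[of _ k])
  then show ?thesis
    unfolding slice_end_contrib[OF assms(1,2)] total_push_def
    by (intro eq_matI)
      (auto simp: mult_add_distrib_mat[of _ k k _ k] add_mult_distrib_mat[of _ k k _ _ k]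
         simp del: index_mult_mat(1))
qed

text \<open>\<open>r + r\<^sup>T = 1 - 2 P\<close> commutes with \<open>A \<otimes> A\<close>. This is why the bracket of an arc with itself can
  be written in two ways.\<close>

lemma flip_exchange:
  assumes "p < k" "q < k"
  shows "mono_mat k a * (slice k p q (M2 k a * rp k) + slice k p q (M2 k a * rpT k)) =
    (slice k p q (rp k * M2 k a) + slice k p q (rpT k * M2 k a)) * mono_mat k a"
proof -
  let ?A = "mono_mat k a"
  let ?c = "const_poly 2 :: 'a entry_poly"
  let ?L = "slice k p q (M2 k a * rp k) + slice k p q (M2 k a * rpT k)"
  let ?R = "slice k p q (rp k * M2 k a) + slice k p q (rpT k * M2 k a)"
  have L: "?L $$ (i, j) = (if i = j then ?A $$ (p, q) else 0) - (if i = q then ?c * ?A $$ (p, j) else 0)"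
    if "i < k" "j < k" for i j
  proof -
    have "?L $$ (i, j) = (\<Sum>t<k. ?A $$ (p, t) *
        (rp k $$ (i * k + t, j * k + q) + rpT k $$ (i * k + t, j * k + q)))"
      using that assms unfolding M2_def slice_def
      by (simp add: index_leg2_mult sum.distrib distrib_left del: index_mult_mat(1))
    also have "\<dots> = (\<Sum>t<k. (if t = q then if i = j then ?A $$ (p, t) else 0 else 0)
        - (if t = j then if i = q then ?c * ?A $$ (p, t) else 0 else 0))"
      using that assms by (intro sum.cong refl) (subst index_rp_add_rpT, auto simp: algebra_simps)
    finally show ?thesis
      using that assms by (simp add: sum_subtractf)
  qed
  have R: "?R $$ (i, j) = (if i = j then ?A $$ (p, q) else 0) - (if p = j then ?c * ?A $$ (i, q) else 0)"
    if "i < k" "j < k" for i j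
  proof -
    have "?R $$ (i, j) = (\<Sum>t<k.
        (rp k $$ (i * k + p, j * k + t) + rpT k $$ (i * k + p, j * k + t)) * ?A $$ (t, q))"
      using that assms unfolding M2_def slice_def
      by (simp add: index_mult_leg2 sum.distrib distrib_right del: index_mult_mat(1))
    also have "\<dots> = (\<Sum>t<k. (if t = p then if i = j then ?A $$ (t, q) else 0 else 0)
        - (if t = i then if p = j then ?c * ?A $$ (t, q) else 0 else 0))"
      using that assms by (intro sum.cong refl) (subst index_rp_add_rpT, auto simp: algebra_simps)
    finally show ?thesis
      using that assms by (simp add: sum_subtractf)
  qed
  have "(?A * ?L) $$ (i, j) = (?R * ?A) $$ (i, j)" if ij: "i < k" "j < k" for i j
  proof -
    have carr: "?L \<in> carrier_mat k k" "?R \<in> carrier_mat k k"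
      by simp_all
    have "(?A * ?L) $$ (i, j) = (\<Sum>s<k. ?A $$ (i, s) * ?L $$ (s, j))"
      using ij by (intro index_mult_mat_sum[of _ k k _ k] M_carrier carr)
    also have "\<dots> = (\<Sum>s<k. (if s = j then ?A $$ (i, s) * ?A $$ (p, q) else 0)
        - (if s = q then ?A $$ (i, s) * (?c * ?A $$ (p, j)) else 0))"
      using ij by (intro sum.cong refl) (subst L, simp_all add: algebra_simps)
    also have "\<dots> = ?A $$ (i, j) * ?A $$ (p, q) - ?c * ?A $$ (i, q) * ?A $$ (p, j)"
      using ij assms by (simp add: sum_subtractf mult.left_commute)
    also have "\<dots> = (\<Sum>s<k. (if s = i then ?A $$ (p, q) * ?A $$ (s, j) else 0)
        - (if s = p then ?c * ?A $$ (i, q) * ?A $$ (s, j) else 0))"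
      using ij assms by (simp add: sum_subtractf mult.commute)
    also have "\<dots> = (\<Sum>s<k. ?R $$ (i, s) * ?A $$ (s, j))"
      using ij by (intro sum.cong refl) (subst R, simp_all add: algebra_simps)
    also have "\<dots> = (?R * ?A) $$ (i, j)"
      using ij by (intro index_mult_mat_sum[of _ k k _ k, symmetric] M_carrier carr)
    finally show ?thesis .
  qed
  then show ?thesis
    by (intro eq_matI) (simp_all del: index_mult_mat(1))
qed

lemma end_pos_inj:
  assumes "complete_arc_system g s n S" "x \<in> arc_ends S" "y \<in> arc_ends S"
    and "cusp_of S x = cusp_of S y" "end_pos S x = end_pos S y"
  shows "x = y"
  using assms unfolding complete_arc_system_def by blast

lemma closed_arc_end_pos:
  assumes "complete_arc_system g s n S" "a \<in> arcs S" "cusp_of S (Src a) = cusp_of S (Tgt a)"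
  shows "end_pos S (Tgt a) < end_pos S (Src a)"
  using assms unfolding complete_arc_system_def by blast

lemma total_push_less_eq_other:
  assumes "complete_arc_system g s n S" "b \<in> arcs S" "v \<in> arc_ends S" "v \<noteq> Src b" "v \<noteq> Tgt b"
  shows "total_push S k p q b (\<le>) v = total_push S k p q b (<) v"
  using assms end_pos_inj[OF assms(1), of v "Src b"] end_pos_inj[OF assms(1), of v "Tgt b"]
  by (auto simp: total_push_def cusp_push_def arc_ends_def le_less)

lemma total_push_less_eq_self:
  assumes "complete_arc_system g s n S" "b \<in> arcs S"
  shows "total_push S k p q b (\<le>) (Src b) =
      total_push S k p q b (<) (Src b) + (slice k p q (M2 k b * rp k) + slice k p q (M2 k b * rpT k))"
    and "total_push S k p q b (\<le>) (Tgt b) =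
      total_push S k p q b (<) (Tgt b) - (slice k p q (rp k * M2 k b) + slice k p q (rpT k * M2 k b))"
  using closed_arc_end_pos[OF assms]
  by (intro eq_matI; cases "cusp_of S (Src b) = cusp_of S (Tgt b)";
      auto simp: total_push_def cusp_push_def simp del: index_mult_mat(1))+

lemma slice_arc_bracket_self:
  assumes "complete_arc_system g s n S" "a \<in> arcs S" "p < k" "q < k"
  shows "slice k p q (arc_bracket S k a a) =
    mono_mat k a * total_push S k p q a (\<le>) (Src a) - total_push S k p q a (<) (Tgt a) * mono_mat k a"
proof (cases "cusp_of S (Src a) = cusp_of S (Tgt a)")
  case True
  have "slice k p q (arc_bracket S k a a) =
      slice k p q (M1 k a * rpT k * M2 k a) - slice k p q (rpT k * M1 k a * M2 k a)
      + slice k p q (M2 k a * M1 k a * rp k) - slice k p q (M2 k a * rp k * M1 k a)"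
    using assms True by (simp add: arc_bracket_def slice_add[of _ k] slice_minus[of _ k] minus_carrier_mat del: assoc_mult_mat)
  then show ?thesis
    using True closed_arc_end_pos[OF assms(1,2) True] assms(3,4)
    by (intro eq_matI)
      (auto simp: slice_M1_M2 total_push_def cusp_push_def mult_add_distrib_mat[of _ k k _ k]
        add_mult_distrib_mat[of _ k k _ _ k] simp del: index_mult_mat(1) assoc_mult_mat)
next
  case False
  have "slice k p q (arc_bracket S k a a) =
      slice k p q (M1 k a * M2 k a * rp k) - slice k p q (rpT k * M1 k a * M2 k a)"
    using assms False by (simp add: arc_bracket_def slice_minus[of _ k] minus_carrier_mat del: assoc_mult_mat)
  then show ?thesis
    using False assms(3,4)
    by (intro eq_matI)
      (auto simp: slice_M1_M2 total_push_def cusp_push_def simp del: index_mult_mat(1) assoc_mult_mat)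
qed

text \<open>
  The self-bracket obeys the rule for different arcs, provided that one end of the arc is regarded
  as lying to the right of itself and the other one to the left of itself; by \<open>flip_exchange\<close> it does
  not matter which. A path can therefore always use the same convention, whichever way it traverses
  the arc: \<open>(<)\<close> at the end from which it departs and \<open>(\<le>)\<close> at the end at which it arrives.
\<close>

lemma slice_arc_bracket:
  assumes "complete_arc_system g s n S" "a \<in> arcs S" "b \<in> arcs S" "p < k" "q < k"
  shows "slice k p q (arc_bracket S k a b) =
      mono_mat k a * total_push S k p q b (\<le>) (Src a) - total_push S k p q b (<) (Tgt a) * mono_mat k a"
    and "slice k p q (arc_bracket S k a b) =
      mono_mat k a * total_push S k p q b (<) (Src a) - total_push S k p q b (\<le>) (Tgt a) * mono_mat k a"
proof -
  let ?A = "mono_mat k a"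
  let ?U = "total_push S k p q b"
  let ?L = "slice k p q (M2 k a * rp k) + slice k p q (M2 k a * rpT k)"
  let ?R = "slice k p q (rp k * M2 k a) + slice k p q (rpT k * M2 k a)"
  have "slice k p q (arc_bracket S k a b) = ?A * ?U (\<le>) (Src a) - ?U (<) (Tgt a) * ?A \<and>
    slice k p q (arc_bracket S k a b) = ?A * ?U (<) (Src a) - ?U (\<le>) (Tgt a) * ?A"
  proof (cases "a = b")
    case True
    have "?A * (?U (<) (Src a) + ?L) - ?U (<) (Tgt a) * ?A = ?A * ?U (<) (Src a) - (?U (<) (Tgt a) - ?R) * ?A"
      unfolding mult_add_distrib_mat[OF M_carrier(1) total_push_carrier add_carrier_mat[OF slice_carrier]]
        minus_mult_distrib_mat[OF total_push_carrier add_carrier_mat[OF slice_carrier] M_carrier(1)]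
        flip_exchange[OF assms(4,5)]
      by (intro eq_matI) (auto simp del: index_mult_mat(1))
    then show ?thesis
      using slice_arc_bracket_self[OF assms(1,2,4,5)] total_push_less_eq_self[OF assms(1,2), of k p q] True
      by simp
  next
    case False
    then show ?thesis
      using slice_arc_bracket_distinct[OF assms(4,5) False]
        total_push_less_eq_other[OF assms(1,3), of "Src a" k p q]
        total_push_less_eq_other[OF assms(1,3), of "Tgt a" k p q] assms(2)
      by (auto simp: arc_ends_def)
  qed
  then show "slice k p q (arc_bracket S k a b) = ?A * ?U (\<le>) (Src a) - ?U (<) (Tgt a) * ?A"
    and "slice k p q (arc_bracket S k a b) = ?A * ?U (<) (Src a) - ?U (\<le>) (Tgt a) * ?A"
    by blast+
qed

lemma M2_in_entry_algebra:
  assumes "b \<in> arcs S"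
  shows "M2 k b \<in> mats_over (entry_algebra S k) (k * k)"
proof (rule mats_overI)
  fix u v assume uv: "u < k * k" "v < k * k"
  then have "k > 0"
    by (cases k) auto
  then have "u div k < k" "v div k < k" "u mod k < k" "v mod k < k"
    using uv by (simp_all add: less_mult_imp_div_less)
  then show "M2 k b $$ (u, v) \<in> entry_algebra S k"
    using uv mats_over_entry[OF mono_mat_in_entry_algebra[OF assms]]
    by (auto simp: M2_def leg2_def kronecker_def intro: entry_algebra_0)
qed simp

lemma rp_in_entry_algebra:
  "rp k \<in> mats_over (entry_algebra S k) (k * k)" "rpT k \<in> mats_over (entry_algebra S k) (k * k)"
  by (auto simp: mats_over_def carrier_matD[OF r_mat_carrier] intro: entry_algebra.const)

lemma slice_in_entry_algebra:
  "R \<in> mats_over (entry_algebra S k) (k * k) \<Longrightarrow> p < k \<Longrightarrow> q < k \<Longrightarrow>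
     slice k p q R \<in> mats_over (entry_algebra S k) k"
  by (intro mats_overI) (auto simp: slice_def tensor_index_less intro: mats_over_entry[of R _ "k * k"])

lemma mats_over_uminus:
  "M \<in> mats_over (entry_algebra S k) n \<Longrightarrow> - M \<in> mats_over (entry_algebra S k) n"
  by (frule mats_over_carrier)
    (auto intro!: mats_overI entry_algebra_uminus dest: mats_over_entry)

lemma total_push_in_entry_algebra:
  assumes "b \<in> arcs S" "p < k" "q < k"
  shows "total_push S k p q b rel v \<in> mats_over (entry_algebra S k) k"
proof -
  have zero: "0\<^sub>m k k \<in> mats_over (entry_algebra S k) k"
    by (auto simp: mats_over_def intro: entry_algebra_0)
  have "push k p q w right \<in> mats_over (entry_algebra S k) k" if "w = Src b \<or> w = Tgt b" for w right
    using that assms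
    by (auto intro!: mats_over_uminus slice_in_entry_algebra mats_over_mult M2_in_entry_algebra
        rp_in_entry_algebra)
  then show ?thesis
    by (auto simp: total_push_def cusp_push_def simp del: push.simps intro!: mats_over_add zero)
qed

lemma var_bracket_eq_slice:
  assumes "i < k" "j < k"
  shows "var_bracket S k (a, i, j) (b, p, q) = slice k p q (arc_bracket S k a b) $$ (i, j)"
  using assms by (simp add: slice_def)

lemma poisson_bracket_in_entry_algebra:
  assumes "complete_arc_system g s n S" "f \<in> entry_algebra S k" "h \<in> entry_algebra S k"
  shows "poisson_bracket S k f h \<in> entry_algebra S k"
  using assms(2)
proof induction
  case (var v)
  have fin: "finite (arcs S)"
    using assms(1) by (simp add: complete_arc_system_def)
  show ?case
    using assms(3)
  proof induction
    case (var w)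
    obtain a i j b p q where vw: "v = (a, i, j)" "w = (b, p, q)"
      by (metis prod_cases3)
    then have mem: "a \<in> arcs S" "b \<in> arcs S" "i < k" "j < k" "p < k" "q < k"
      using \<open>v \<in> entry_vars S k\<close> var by (auto simp: entry_vars_def)
    have "slice k p q (arc_bracket S k a b) \<in> mats_over (entry_algebra S k) k"
      unfolding slice_arc_bracket(1)[OF assms(1) mem(1,2,5,6)] using mem
      by (intro mats_over_minus mats_over_mult mono_mat_in_entry_algebra total_push_in_entry_algebra)
    then have "var_bracket S k v w \<in> entry_algebra S k"
      unfolding vw var_bracket_eq_slice[OF mem(3,4)] using mem by (auto dest: mats_over_entry)
    then show ?case
      by (simp add: poisson_bracket_var[OF fin \<open>v \<in> entry_vars S k\<close> var])
  qed (auto simp: poisson_bracket_const poisson_bracket_add_right poisson_bracket_mult_right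
      intro: entry_algebra_0 entry_algebra.add entry_algebra.mult entry_algebra.var
        \<open>v \<in> entry_vars S k\<close>)
qed (auto simp: poisson_bracket_const poisson_bracket_add_left poisson_bracket_mult_left
    intro: entry_algebra_0 entry_algebra.add entry_algebra.mult)

section \<open>The bracket of a path with one matrix entry\<close>

definition bracket_mat ::
    "('a, 'c) arc_system \<Rightarrow> nat \<Rightarrow> 'a \<times> nat \<times> nat \<Rightarrow> 'a entry_poly mat \<Rightarrow> 'a entry_poly mat" where
  "bracket_mat S k v M = map_mat (\<lambda>f. poisson_bracket S k f (entry_var v)) M"

lemma bracket_mat_carrier [simp]: "bracket_mat S k v M \<in> carrier_mat m n \<longleftrightarrow> M \<in> carrier_mat m n"
  by (simp add: bracket_mat_def)

lemma poisson_bracket_sum_left: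
  "poisson_bracket S k (\<Sum>x\<in>X. f x) h = (\<Sum>x\<in>X. poisson_bracket S k (f x) h)"
  by (induction X rule: infinite_finite_induct)
    (simp_all add: poisson_bracket_add_left poisson_bracket_zero)

lemma bracket_mat_mult:
  assumes "M \<in> carrier_mat n m" "N \<in> carrier_mat m l"
  shows "bracket_mat S k v (M * N) = bracket_mat S k v M * N + M * bracket_mat S k v N"
proof (rule eq_matI)
  fix i j
  assume "i < dim_row (bracket_mat S k v M * N + M * bracket_mat S k v N)"
    and "j < dim_col (bracket_mat S k v M * N + M * bracket_mat S k v N)"
  then have ij: "i < n" "j < l"
    using assms by (auto simp: bracket_mat_def)
  have "bracket_mat S k v (M * N) $$ (i, j) =
      (\<Sum>s<m. poisson_bracket S k (M $$ (i, s) * N $$ (s, j)) (entry_var v))"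
    using assms ij
    by (simp add: bracket_mat_def index_mult_mat_sum[of _ n m _ l] poisson_bracket_sum_left
        del: index_mult_mat(1))
  also have "\<dots> = (bracket_mat S k v M * N) $$ (i, j) + (M * bracket_mat S k v N) $$ (i, j)"
    using assms ij
    by (simp add: index_mult_mat_sum[of _ n m _ l] sum.distrib poisson_bracket_mult_left
        bracket_mat_def del: index_mult_mat(1))
  finally show "bracket_mat S k v (M * N) $$ (i, j) =
      (bracket_mat S k v M * N + M * bracket_mat S k v N) $$ (i, j)"
    using assms ij by (simp add: bracket_mat_def)
qed (use assms in \<open>auto simp: bracket_mat_def\<close>)

lemma bracket_mat_in_entry_algebra:
  assumes "complete_arc_system g s n S" "v \<in> entry_vars S k" "M \<in> mats_over (entry_algebra S k) k"
  shows "bracket_mat S k v M \<in> mats_over (entry_algebra S k) k"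
  using mats_over_carrier[OF assms(3)] assms
  by (auto simp: bracket_mat_def intro!: mats_overI poisson_bracket_in_entry_algebra
      entry_algebra.var dest: mats_over_entry)

lemma bracket_mat_mono_mat:
  assumes "complete_arc_system g s n S" "a \<in> arcs S" "b \<in> arcs S" "p < k" "q < k"
  shows "bracket_mat S k (b, p, q) (mono_mat k a) = slice k p q (arc_bracket S k a b)"
proof -
  have "finite (arcs S)"
    using assms(1) by (simp add: complete_arc_system_def)
  then show ?thesis
    using assms
    by (intro eq_matI)
      (auto simp: bracket_mat_def mono_mat_def slice_def poisson_bracket_var entry_vars_def)
qed

text \<open>
  The derivation applied to \<open>A * adj A = det A\<close>, multiplied by \<open>adj A\<close> from the left. The bracket of
  \<open>det A\<close> is not computed: it enters only as the factor of a multiple of \<open>adj A\<close>.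
\<close>

lemma bracket_adj_mat:
  assumes A: "A \<in> carrier_mat k k" and U: "U \<in> carrier_mat k k" and V: "V \<in> carrier_mat k k"
    and DA: "bracket_mat S m v A = A * U - V * A"
  shows "det A \<cdot>\<^sub>m (bracket_mat S m v (adj_mat A) - (adj_mat A * V - U * adj_mat A)) =
    poisson_bracket S m (det A) (entry_var v) \<cdot>\<^sub>m adj_mat A"
proof -
  let ?N = "adj_mat A" and ?d = "det A"
  let ?D = "bracket_mat S m v ?N"
  let ?c = "poisson_bracket S m ?d (entry_var v)"
  note N = adj_mat(1)[OF A] and AN = adj_mat(2)[OF A] and NA = adj_mat(3)[OF A]
  note assoc = assoc_mult_mat[of _ k k _ k _ k]
  have D: "?D \<in> carrier_mat k k"
    using N by simp
  have "bracket_mat S m v (?d \<cdot>\<^sub>m 1\<^sub>m k) = ?c \<cdot>\<^sub>m 1\<^sub>m k"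
    by (intro eq_matI) (auto simp: bracket_mat_def poisson_bracket_zero)
  then have "?c \<cdot>\<^sub>m 1\<^sub>m k = (A * U - V * A) * ?N + A * ?D"
    using bracket_mat_mult[OF A N, of S m v] by (simp add: AN DA)
  then have "?N * (?c \<cdot>\<^sub>m 1\<^sub>m k) = ?N * ((A * U - V * A) * ?N + A * ?D)"
    by simp
  also have "\<dots> = ?N * (A * U * ?N) - ?N * (V * A * ?N) + ?N * (A * ?D)"
    using A U V N D
    by (simp add: mult_add_distrib_mat[of _ k k _ k] mult_minus_distrib_mat[of _ k k _ k]
        minus_mult_distrib_mat[of _ k k _ _ k] minus_carrier_mat)
  also have "?N * (A * U * ?N) = ?N * A * U * ?N"
    using A U N by (simp add: assoc)
  also have "\<dots> = ?d \<cdot>\<^sub>m (U * ?N)"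
    using U N by (simp add: NA mult_smult_assoc_mat[of _ k k _ k])
  also have "?N * (V * A * ?N) = ?N * V * (A * ?N)"
    using A V N by (simp add: assoc)
  also have "\<dots> = ?d \<cdot>\<^sub>m (?N * V)"
    using V N by (simp add: AN mult_smult_distrib[of _ k k _ k] del: assoc_mult_mat)
  also have "?N * (A * ?D) = ?N * A * ?D"
    using A D N by (simp add: assoc)
  also have "\<dots> = ?d \<cdot>\<^sub>m ?D"
    using D by (simp add: NA mult_smult_assoc_mat[of _ k k _ k])
  finally have "?c \<cdot>\<^sub>m ?N = ?d \<cdot>\<^sub>m (U * ?N) - ?d \<cdot>\<^sub>m (?N * V) + ?d \<cdot>\<^sub>m ?D"
    using N by (simp add: mult_smult_distrib[of _ k k _ k])
  then show ?thesis
    using U V N D by (auto simp: algebra_simps simp del: index_mult_mat(1) intro!: eq_matI)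
qed

text \<open>
  Both directions of traversal give the same formula, up to a scalar multiple of the matrix itself,
  which is harmless for a condition that entries vanish, and up to the relations \<open>det = 1\<close>.
\<close>

lemma bracket_end_mat:
  assumes S: "complete_arc_system g s n S" and x: "x \<in> arc_ends S"
    and b: "b \<in> arcs S" "p < k" "q < k"
  shows "\<exists>c\<in>entry_algebra S k. \<exists>Z\<in>mats_over (gen_ideal (entry_algebra S k) (sl_relations S k)) k.
    bracket_mat S k (b, p, q) (end_mat k x) = c \<cdot>\<^sub>m end_mat k x
      + (end_mat k x * total_push S k p q b (<) x
         - total_push S k p q b (\<le>) (other_end x) * end_mat k x) + Z"
proof (cases x)
  case (Src a)
  then have a: "a \<in> arcs S"
    using x by (auto simp: arc_ends_def)
  have "0\<^sub>m k k \<in> mats_over (gen_ideal (entry_algebra S k) (sl_relations S k)) k"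
    by (auto simp: mats_over_def intro: gen_ideal.zero)
  moreover have "bracket_mat S k (b, p, q) (end_mat k x) = 0 \<cdot>\<^sub>m end_mat k x
      + (end_mat k x * total_push S k p q b (<) x
         - total_push S k p q b (\<le>) (other_end x) * end_mat k x) + 0\<^sub>m k k"
    using bracket_mat_mono_mat[OF S a b] slice_arc_bracket(2)[OF S a b] Src
    by (auto simp del: index_mult_mat(1) intro!: eq_matI)
  ultimately show ?thesis
    using entry_algebra_0 by blast
next
  case (Tgt a)
  then have a: "a \<in> arcs S"
    using x by (auto simp: arc_ends_def)
  let ?A = "mono_mat k a" and ?v = "(b, p, q)"
  let ?N = "adj_mat ?A" and ?d = "det (mono_mat k a)"
  let ?U = "total_push S k p q b (\<le>) (Src a)" and ?V = "total_push S k p q b (<) (Tgt a)"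
  define c where "c = poisson_bracket S k ?d (entry_var ?v)"
  \<comment> \<open>\<open>W\<close> is the deviation from the rule; \<open>det A * W = c * adj A\<close> splits it into \<open>c * adj A\<close> and
    a multiple of \<open>1 - det A\<close>.\<close>
  define W where "W = bracket_mat S k ?v ?N - (?N * ?V - ?U * ?N)"
  note Amem = mono_mat_in_entry_algebra[OF a, of k]
  note Nmem = adj_mat_in_entry_algebra[OF Amem]
  have v: "?v \<in> entry_vars S k"
    using b by (simp add: entry_vars_def)
  have N: "?N \<in> carrier_mat k k"
    by (rule adj_mat) simp
  have c: "c \<in> entry_algebra S k"
    unfolding c_def using S det_in_entry_algebra[OF Amem] entry_algebra.var[OF v]
    by (rule poisson_bracket_in_entry_algebra)
  have Wmem: "W \<in> mats_over (entry_algebra S k) k"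
    unfolding W_def using b
    by (intro mats_over_minus mats_over_mult bracket_mat_in_entry_algebra[OF S v] Nmem
        total_push_in_entry_algebra)
  note W = mats_over_carrier[OF Wmem]
  have "bracket_mat S k ?v ?A = ?A * ?U - ?V * ?A"
    using bracket_mat_mono_mat[OF S a b] slice_arc_bracket(1)[OF S a b] by simp
  then have dW: "?d \<cdot>\<^sub>m W = c \<cdot>\<^sub>m ?N"
    unfolding W_def c_def
    by (rule bracket_adj_mat[OF M_carrier(1) total_push_carrier total_push_carrier])
  have "(1 - ?d) \<cdot>\<^sub>m W \<in> mats_over (gen_ideal (entry_algebra S k) (sl_relations S k)) k"
  proof (rule mats_overI)
    fix i j assume ij: "i < k" "j < k"
    have "- (W $$ (i, j)) * (?d - 1) \<in> gen_ideal (entry_algebra S k) (sl_relations S k)"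
      using a mats_over_entry[OF Wmem ij]
      by (intro gen_ideal_generator entry_algebra_uminus) (auto simp: sl_relations_def)
    then show "((1 - ?d) \<cdot>\<^sub>m W) $$ (i, j) \<in> gen_ideal (entry_algebra S k) (sl_relations S k)"
      using W ij by (simp add: algebra_simps)
  qed (use W in simp)
  moreover have "bracket_mat S k ?v (end_mat k x) = c \<cdot>\<^sub>m end_mat k x
      + (end_mat k x * total_push S k p q b (<) x
         - total_push S k p q b (\<le>) (other_end x) * end_mat k x) + (1 - ?d) \<cdot>\<^sub>m W"
  proof -
    have "bracket_mat S k ?v ?N = (?N * ?V - ?U * ?N) + W"
      unfolding W_def using N by (intro eq_matI) (auto simp: bracket_mat_def simp del: index_mult_mat(1))
    also have "W = ?d \<cdot>\<^sub>m W + (1 - ?d) \<cdot>\<^sub>m W"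
      using W by (intro eq_matI) (auto simp: algebra_simps)
    finally show ?thesis
      unfolding dW using N W Tgt by (auto simp: algebra_simps simp del: index_mult_mat(1) intro!: eq_matI)
  qed
  ultimately show ?thesis
    using c by blast
qed

text \<open>No end lies between two neighbours, so every end of \<open>b\<close> at their cusp is to the left of both or
  to the right of both, with the convention for self-positions included.\<close>

lemma total_push_right_neighbour:
  assumes "right_neighbour S x y" "b \<in> arcs S"
  shows "total_push S k p q b (\<le>) x = total_push S k p q b (<) y"
proof -
  have "end_pos S x \<le> end_pos S w \<longleftrightarrow> end_pos S y < end_pos S w"
    if "w \<in> arc_ends S" "cusp_of S w = cusp_of S x" for w
    using assms(1) that unfolding right_neighbour_def 
    by (metis le_less_trans not_le_imp_less)
  moreover have "cusp_of S x = cusp_of S y"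
    using assms(1) by (simp add: right_neighbour_def)
  moreover have "Src b \<in> arc_ends S" "Tgt b \<in> arc_ends S"
    using assms(2) by (auto simp: arc_ends_def)
  ultimately show ?thesis
    by (auto simp: total_push_def cusp_push_def)
qed

text \<open>The pushes at the cusps that a path only touches cancel in pairs, so that a path obeys the same
  formula as a single arc.\<close>

lemma bracket_path_mat:
  assumes S: "complete_arc_system g s n S" and b: "b \<in> arcs S" "p < k" "q < k"
    and "xs \<noteq> []" "set xs \<subseteq> arc_ends S"
    and "\<forall>i. Suc i < length xs \<longrightarrow> right_neighbour S (other_end (xs ! i)) (xs ! Suc i)"
  shows "\<exists>c\<in>entry_algebra S k. \<exists>Z\<in>mats_over (gen_ideal (entry_algebra S k) (sl_relations S k)) k.
    bracket_mat S k (b, p, q) (path_mat k xs) = c \<cdot>\<^sub>m path_mat k xs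
      + (path_mat k xs * total_push S k p q b (<) (hd xs)
         - total_push S k p q b (\<le>) (other_end (last xs)) * path_mat k xs) + Z"
  using assms(5-)
proof (induction xs rule: list_nonempty_induct)
  case (single x)
  then have "end_mat k x \<in> carrier_mat k k"
    using end_mat_in_entry_algebra[THEN mats_over_carrier] by force
  then show ?case
    using bracket_end_mat[OF S _ b, of x] single by simp
next
  case (cons x xs)
  let ?D = "bracket_mat S k (b, p, q)"
  let ?U = "total_push S k p q b"
  let ?X = "path_mat k xs" and ?E = "end_mat k x"
  let ?I = "gen_ideal (entry_algebra S k) (sl_relations S k)"
  let ?y = "hd xs" and ?z = "other_end (last xs)"
  have nb: "right_neighbour S (other_end x) ?y"
    using cons.prems(2) cons.hyps by (auto simp: hd_conv_nth dest: spec[of _ 0])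
  have "\<forall>i. Suc i < length xs \<longrightarrow> right_neighbour S (other_end (xs ! i)) (xs ! Suc i)"
    using cons.prems(2) by (metis Suc_mono length_Cons nth_Cons_Suc)
  with cons obtain c Z where c: "c \<in> entry_algebra S k" and Z: "Z \<in> mats_over ?I k"
    and DX: "?D ?X = c \<cdot>\<^sub>m ?X + (?X * ?U (<) ?y - ?U (\<le>) ?z * ?X) + Z"
    by auto
  obtain c' Z' where c': "c' \<in> entry_algebra S k" and Z': "Z' \<in> mats_over ?I k"
    and DE: "?D ?E = c' \<cdot>\<^sub>m ?E + (?E * ?U (<) x - ?U (\<le>) (other_end x) * ?E) + Z'"
    using bracket_end_mat[OF S _ b, of x] cons.prems(1) by auto
  have mem: "?X \<in> mats_over (entry_algebra S k) k" "?E \<in> mats_over (entry_algebra S k) k"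
    using cons.prems(1) by (auto intro: path_mat_in_entry_algebra end_mat_in_entry_algebra)
  note carr = mem[THEN mats_over_carrier] Z[THEN mats_over_carrier] Z'[THEN mats_over_carrier]
  note assoc = assoc_mult_mat[of _ k k _ k _ k]
  have rem: "Z * ?E + ?X * Z' \<in> mats_over ?I k"
    using mem Z Z' by (intro mats_over_ideal_add mats_over_ideal_mult_left mats_over_ideal_mult_right)
  have "?D (?X * ?E) = ?D ?X * ?E + ?X * ?D ?E"
    using carr by (intro bracket_mat_mult)
  also have "?D ?X * ?E = c \<cdot>\<^sub>m (?X * ?E) + (?X * (?U (<) ?y * ?E) - ?U (\<le>) ?z * (?X * ?E)) + Z * ?E"
    unfolding DX using carr
    by (simp add: add_mult_distrib_mat[of _ k k _ _ k] minus_mult_distrib_mat[of _ k k _ _ k]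
        mult_smult_assoc_mat[of _ k k _ k] assoc minus_carrier_mat)
  also have "?X * ?D ?E = c' \<cdot>\<^sub>m (?X * ?E) + (?X * ?E * ?U (<) x - ?X * (?U (<) ?y * ?E)) + ?X * Z'"
    unfolding DE total_push_right_neighbour[OF nb b(1)] using carr
    by (simp add: mult_add_distrib_mat[of _ k k _ k] mult_minus_distrib_mat[of _ k k _ k]
        mult_smult_distrib[of _ k k _ k] assoc minus_carrier_mat)
  also have "c \<cdot>\<^sub>m (?X * ?E) + (?X * (?U (<) ?y * ?E) - ?U (\<le>) ?z * (?X * ?E)) + Z * ?E
      + (c' \<cdot>\<^sub>m (?X * ?E) + (?X * ?E * ?U (<) x - ?X * (?U (<) ?y * ?E)) + ?X * Z') =
      (c + c') \<cdot>\<^sub>m (?X * ?E) + (?X * ?E * ?U (<) x - ?U (\<le>) ?z * (?X * ?E)) + (Z * ?E + ?X * Z')"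
    using carr by (auto simp: algebra_simps simp del: index_mult_mat(1) assoc_mult_mat intro!: eq_matI)
  finally show ?case
    using rem entry_algebra.add[OF c c'] cons.hyps by auto
qed

section \<open>Boundary paths\<close>

text \<open>At a leftmost end only \<open>r\<^sup>T\<close> occurs, and at a rightmost end only \<open>r\<close>.\<close>

lemma total_push_leftmost:
  assumes "leftmost_end S x" "b \<in> arcs S" "p < k" "q < k" "i < j" "j < k"
  shows "total_push S k p q b (<) x $$ (i, j) = 0"
proof -
  have "push k p q w False $$ (i, j) = 0" if "w = Src b \<or> w = Tgt b" for w
    using that assms(3-)
    by (auto simp: M2_def slice_def index_leg2_mult index_mult_leg2 rpT_lower_triangular simp del: index_mult_mat(1))
  moreover have "\<not> end_pos S x < end_pos S w" if "w = Src b \<or> w = Tgt b" "cusp_of S x = cusp_of S w" for w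
    using assms(1,2) that by (force simp: leftmost_end_def arc_ends_def)
  ultimately show ?thesis
    using assms(3-)
    by (auto simp: total_push_def cusp_push_def carrier_matD[OF push_carrier] simp del: push.simps)
qed

lemma total_push_rightmost:
  assumes "rightmost_end S x" "b \<in> arcs S" "p < k" "q < k" "j < i" "i < k"
  shows "total_push S k p q b (\<le>) x $$ (i, j) = 0"
proof -
  have "push k p q w True $$ (i, j) = 0" if "w = Src b \<or> w = Tgt b" for w
    using that assms(3-)
    by (auto simp: M2_def slice_def index_leg2_mult index_mult_leg2 rp_upper_triangular simp del: index_mult_mat(1))
  moreover have "end_pos S x \<le> end_pos S w" if "w = Src b \<or> w = Tgt b" "cusp_of S x = cusp_of S w" for w
    using assms(1,2) that by (force simp: rightmost_end_def arc_ends_def)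
  ultimately show ?thesis
    using assms(3-)
    by (auto simp: total_push_def cusp_push_def carrier_matD[OF push_carrier] simp del: push.simps)
qed

text \<open>
  The column operations from the start of the path and the row operations from its end produce only
  entries of the path matrix that lie again below the antidiagonal.
\<close>

lemma bracket_boundary_entry:
  assumes S: "complete_arc_system g s n S" and xs: "boundary_path S xs"
    and E: "below_antidiag k (path_mat k xs) \<subseteq> E"
    and e: "e \<in> below_antidiag k (path_mat k xs)" and w: "w \<in> entry_vars S k"
  shows "poisson_bracket S k e (entry_var w) \<in> gen_ideal (entry_algebra S k) (E \<union> sl_relations S k)"
proof -
  let ?I = "gen_ideal (entry_algebra S k) (E \<union> sl_relations S k)"
  let ?X = "path_mat k xs"
  obtain b p q where w_eq: "w = (b, p, q)" and b: "b \<in> arcs S" "p < k" "q < k"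
    using w by (auto simp: entry_vars_def)
  obtain i j where e_eq: "e = ?X $$ (i, j)" and ij: "i < k" "j < k" "k \<le> i + j"
    using e by (auto simp: below_antidiag_def)
  let ?U = "total_push S k p q b (<) (hd xs)"
  let ?V = "total_push S k p q b (\<le>) (other_end (last xs))"
  obtain c Z where c: "c \<in> entry_algebra S k"
    and Z: "Z \<in> mats_over (gen_ideal (entry_algebra S k) (sl_relations S k)) k"
    and D: "bracket_mat S k w ?X = c \<cdot>\<^sub>m ?X + (?X * ?U - ?V * ?X) + Z"
    using bracket_path_mat[OF S b, of xs] xs unfolding boundary_path_def w_eq by blast
  have X: "?X \<in> carrier_mat k k"
    using xs path_mat_in_entry_algebra mats_over_carrier unfolding boundary_path_def by blast
  have mono: "h \<in> ?I" if "h \<in> gen_ideal (entry_algebra S k) (sl_relations S k)" for h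
    using that by induction (auto intro: gen_ideal.intros)
  have zero_entry: "f * ?X $$ (i', j') \<in> ?I"
    if "f \<in> entry_algebra S k" "i' < k" "j' < k" "k \<le> i' + j'" for f i' j'
    using that E by (intro gen_ideal_generator) (force simp: below_antidiag_def)+
  have U: "?U $$ (s, j) \<in> entry_algebra S k" and V: "?V $$ (i, s) \<in> entry_algebra S k" if "s < k" for s
    using total_push_in_entry_algebra[OF b] that ij by (auto intro: mats_over_entry)
  have "(?X * ?U) $$ (i, j) = (\<Sum>s<k. ?U $$ (s, j) * ?X $$ (i, s))"
    using X ij by (simp add: index_mult_mat_sum[of _ k k _ k] mult.commute del: index_mult_mat(1))
  also have "\<dots> \<in> ?I"
  proof (rule gen_ideal_sum)
    fix s assume s: "s \<in> {..<k}"
    show "?U $$ (s, j) * ?X $$ (i, s) \<in> ?I"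
    proof (cases "s < j")
      case True
      then show ?thesis
        using total_push_leftmost[of S "hd xs" b p k q s j] b xs ij
        by (simp add: boundary_path_def gen_ideal.zero)
    qed (use s ij U zero_entry in auto)
  qed
  finally have XU: "(?X * ?U) $$ (i, j) \<in> ?I" .
  have "- (?V * ?X) $$ (i, j) = (\<Sum>s<k. - ?V $$ (i, s) * ?X $$ (s, j))"
    using X ij by (simp add: index_mult_mat_sum[of _ k k _ k] sum_negf del: index_mult_mat(1))
  also have "\<dots> \<in> ?I"
  proof (rule gen_ideal_sum)
    fix s assume s: "s \<in> {..<k}"
    show "- ?V $$ (i, s) * ?X $$ (s, j) \<in> ?I"
    proof (cases "s < i")
      case True
      then show ?thesis
        using total_push_rightmost[of S "other_end (last xs)" b p k q s i] b xs ij
        by (simp add: boundary_path_def gen_ideal.zero)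
    next
      case False
      then show ?thesis
        using s ij V by (intro zero_entry entry_algebra_uminus) auto
    qed
  qed
  finally have VX: "- (?V * ?X) $$ (i, j) \<in> ?I" .
  have "poisson_bracket S k e (entry_var w) = bracket_mat S k w ?X $$ (i, j)"
    using X ij by (simp add: bracket_mat_def e_eq)
  also have "\<dots> = c * ?X $$ (i, j) + ((?X * ?U) $$ (i, j) + - (?V * ?X) $$ (i, j)) + Z $$ (i, j)"
    using X mats_over_carrier[OF Z] ij unfolding D by (simp del: index_mult_mat(1))
  also have "\<dots> \<in> ?I"
    using XU VX zero_entry[OF c ij] mono[OF mats_over_entry[OF Z ij(1,2)]]
    by (intro gen_ideal_add)
  finally show ?thesis .
qed

lemma boundary_entry_in_entry_algebra:
  assumes "boundary_path S xs" "e \<in> below_antidiag k (path_mat k xs)"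
  shows "e \<in> entry_algebra S k"
  using assms path_mat_in_entry_algebra[of xs S k]
  by (auto simp: boundary_path_def below_antidiag_def dest: mats_over_entry)

text \<open>By the Leibniz rule only the generators of both sides matter.\<close>

lemma poisson_reductionI:
  assumes S: "complete_arc_system g s n S"
    and gen: "\<And>e w. e \<in> E \<Longrightarrow> w \<in> entry_vars S k \<Longrightarrow>
      poisson_bracket S k e (entry_var w) \<in> gen_ideal (entry_algebra S k) (E \<union> sl_relations S k)"
    and E: "E \<subseteq> entry_algebra S k"
  shows "poisson_reduction S k E"
  unfolding poisson_reduction_def
proof (intro ballI)
  let ?A = "entry_algebra S k"
  let ?I = "gen_ideal ?A (E \<union> sl_relations S k)"
  fix h f assume "h \<in> gen_ideal ?A E" and f: "f \<in> ?A"
  have bracket_e: "poisson_bracket S k e f \<in> ?I" if e: "e \<in> E" for e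
    using f
  proof induction
    case (mult f h)
    then have "h * poisson_bracket S k e f + f * poisson_bracket S k e h \<in> ?I"
      by (intro gen_ideal_add gen_ideal_mult)
    then show ?case
      by (simp add: poisson_bracket_mult_right mult.commute)
  qed (auto simp: poisson_bracket_const poisson_bracket_add_right
      intro: gen_ideal.zero gen_ideal_add gen e)
  from \<open>h \<in> gen_ideal ?A E\<close> show "poisson_bracket S k h f \<in> ?I"
  proof induction
    case (step c e h)
    have "poisson_bracket S k c f * e + (c * poisson_bracket S k e f + poisson_bracket S k h f) \<in> ?I"
      using step bracket_e[OF step(2)] poisson_bracket_in_entry_algebra[OF S step(1) f]
      by (intro gen_ideal_add gen_ideal_generator gen_ideal_mult) auto
    then show ?case
      by (simp add: poisson_bracket_add_left poisson_bracket_mult_left add.assoc)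
  qed (simp add: poisson_bracket_zero gen_ideal.zero)
qed

theorem lemma3p2:
  fixes S :: "('a, 'c) arc_system" and g s n k :: nat and P :: "'a arc_end list set"
  assumes "complete_arc_system g s n S"
    and "k \<ge> 1"
    and "\<forall>xs\<in>P. boundary_path S xs"
  shows "poisson_reduction S k (\<Union>xs\<in>P. below_antidiag k (path_mat k xs))"
proof (rule poisson_reductionI[OF assms(1)])
  fix e w
  assume "e \<in> (\<Union>xs\<in>P. below_antidiag k (path_mat k xs))" and w: "w \<in> entry_vars S k"
  then obtain xs where xs: "xs \<in> P" "e \<in> below_antidiag k (path_mat k xs)"
    by blast
  then show "poisson_bracket S k e (entry_var w) \<in> gen_ideal (entry_algebra S k)
      ((\<Union>xs\<in>P. below_antidiag k (path_mat k xs)) \<union> sl_relations S k)"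
    using assms(1,3) w by (intro bracket_boundary_entry[of g s n S xs]) auto
next
  show "(\<Union>xs\<in>P. below_antidiag k (path_mat k xs)) \<subseteq> entry_algebra S k"
    using assms(3) boundary_entry_in_entry_algebra by blast
qed

end
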